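(* Let $(\mathsf{X},\mathsf{d})$ be a proper metric space (every closed ball is compact). For each $n\in\mathbb{N}\cup\{\infty\}$ let $X_n$ be a nonempty compact subset of $\mathsf{X}$, equipped with the intrinsic (length) metric $d_n$ induced from $\mathsf{d}$, and assume that $(X_n,d_n)$ is a complete geodesic space. Let $H_n: X_n\times\mathbb{R}\times\mathbb{R}_+\to\mathbb{R}$ for $n\in\mathbb{N}\cup\{\infty\}$. For $x\in X_\infty$ let $S(x)$ be the set of sequences $(x_n)_{n\in\mathbb{N}}$ with $x_n\in X_n$ for all $n$ and $\mathsf{d}(x_n,x)\to 0$. Assume: (1) $\max\{\sup_{x\in X_n}\mathsf{d}(X_\infty,x),\ \sup_{x\in X_\infty}\mathsf{d}(X_n,x)\}\to 0$ as $n\to\infty$, where $\mathsf{d}(A,x)=\inf_{a\in A}\mathsf{d}(a,x)$; (2) for all $a_\infty,b_\infty\in X_\infty$, $(a_n)\in S(a_\infty)$ and $(b_n)\in S(b_\infty)$ one has $d_n(a_n,b_n)\to d_\infty(a_\infty,b_\infty)$; (3) for all $x_\infty\in X_\infty$, $(x_n)\in S(x_\infty)$, $u_n\to u_\infty$ in $\mathbb{R}$ and $p_n\to p_\infty$ in $\mathbb{R}_+$ one has $H_n(x_n,u_n,p_n)\to H_\infty(x_\infty,u_\infty,p_\infty)$. Then the following hold. (a) Suppose that for each $n\in\mathbb{N}$, $u^n:X_n\to\mathbb{R}$ is a metric viscosity subsolution of $H_n(x,u^n(x),|\nabla_{d_n}u^n|(x))=0$ on $(X_n,d_n)$. If the upper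 semilimit $$\overline{u}^\infty(x):=\sup_{(x_n)\in S(x)}\limsup_{n\to\infty}u^n(x_n),\qquad x\in X_\infty,$$ is real-valued and upper semicontinuous with respect to $d_\infty$, then $\overline{u}^\infty$ is a metric viscosity subsolution of $H_\infty(x,u(x),|\nabla_{d_\infty}u|(x))=0$ on $(X_\infty,d_\infty)$. (b) Suppose that for each $n\in\mathbb{N}$, $u^n:X_n\to\mathbb{R}$ is a metric viscosity supersolution of $H_n(x,u^n(x),|\nabla_{d_n}u^n|(x))=0$ on $(X_n,d_n)$. If the lower semilimit $$\underline{u}^\infty(x):=\inf_{(x_n)\in S(x)}\liminf_{n\to\infty}u^n(x_n),\qquad x\in X_\infty,$$ is real-valued and lower semicontinuous with respect to $d_\infty$, then $\underline{u}^\infty$ is a metric viscosity supersolution of $H_\infty(x,u(x),|\nabla_{d_\infty}u|(x))=0$ on $(X_\infty,d_\infty)$.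
   Context: $\mathbb{R}_+=[0,\infty)$. Let $(X,d)$ be a complete geodesic space and $H:X\times\mathbb{R}\times\mathbb{R}_+\to\mathbb{R}$. All topological notions on $X$ (local maxima, semicontinuity, envelopes, local Lipschitz continuity) are with respect to $d$. Slopes. For a locally Lipschitz $u:X\to\mathbb{R}$, $$|\nabla_d u|(x)=\limsup_{y\to x}\frac{|u(y)-u(x)|}{d(x,y)},\qquad |\nabla_d^{\pm}u|(x)=\limsup_{y\to x}\frac{[u(y)-u(x)]_\pm}{d(x,y)},$$ with $[a]_\pm=\max\{\pm a,0\}$ (and value $0$ at an isolated point). A locally Lipschitz $u$ is $C^{1,+}$ (resp. $C^{1,-}$) if $|\nabla_d u|$ is continuous and $|\nabla_d^{+}u|=|\nabla_d u|$ (resp. $|\nabla_d^{-}u|=|\nabla_d u|$) everywhere. Envelopes. $u^*$ and $u_*$ are the upper and lower semicontinuous envelopes of $u$; $|\nabla_d\psi|^*$ is the upper semicontinuous envelope of $|\nabla_d\psi|$. For subsolutions $u^*$ is understood to be real-valued, for supersolutions $u_*$ is understood to be real-valued. Modified Hamiltonians. For $a\ge 0$, $H_a(x,u,p)=\inf\{H(x,u,p'):p'\ge0,\ |p'-p|\le a\}$ and $H^a(x,u,p)=\sup\{H(x,u,p'):p'\ge0,\ |p'-p|\le a\}$. Test functions. $\psi=\psi_1+\psi_2$ is a test function for subsolutions (resp. supersolutions) if $\psi_1$ is $C^{1,-}$ (resp. $C^{1,+}$) and $\psi_2$ is locally Lipschitz on $X$. Metric viscosity solutions of $H(x,u(x),|\nabla_d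 u|(x))=0$ on $X$. A function $u:X\to\mathbb{R}$ is a metric viscosity subsolution if, for every test function $\psi=\psi_1+\psi_2$ for subsolutions such that $u^*-\psi$ attains a local maximum at $\hat x\in X$, one has $H_{|\nabla_d\psi_2|^*(\hat x)}(\hat x,u^*(\hat x),|\nabla_d\psi_1|(\hat x))\le 0$. It is a metric viscosity supersolution if, for every test function $\psi=\psi_1+\psi_2$ for supersolutions such that $u_*-\psi$ attains a local minimum at $\hat x\in X$, one has $H^{|\nabla_d\psi_2|^*(\hat x)}(\hat x,u_*(\hat x),|\nabla_d\psi_1|(\hat x))\ge 0$. *)

theory Defs
  imports "HOL-Analysis.Analysis"
begin

section \<open>Intrinsic metrics and geodesic spaces\<close>

definition curve_length :: "(real \<Rightarrow> 'a::metric_space) \<Rightarrow> ereal" where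
  "curve_length g =
     (SUP ts \<in> {ts. sorted ts \<and> set ts \<subseteq> {0..1}}.
        ereal (\<Sum>i<length ts - 1. dist (g (ts ! i)) (g (ts ! Suc i))))"

definition intrinsic_edist :: "'a::metric_space set \<Rightarrow> 'a \<Rightarrow> 'a \<Rightarrow> ereal" where
  "intrinsic_edist S x y =
     (INF g \<in> {g. path g \<and> path_image g \<subseteq> S \<and> pathstart g = x \<and> pathfinish g = y}. curve_length g)"

text \<open>The real-valued version sends the value \<open>\<infinity>\<close> (no rectifiable curve between the points)
  to \<open>0\<close>. For distinct points this is excluded as soon as \<open>Metric_space S (intrinsic_dist S)\<close> holds.\<close>

definition intrinsic_dist :: "'a::metric_space set \<Rightarrow> 'a \<Rightarrow> 'a \<Rightarrow> real" where
  "intrinsic_dist S x y = real_of_ereal (intrinsic_edist S x y)"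

definition complete_geodesic_space :: "'a set \<Rightarrow> ('a \<Rightarrow> 'a \<Rightarrow> real) \<Rightarrow> bool" where
  "complete_geodesic_space M d \<longleftrightarrow>
     Metric_space M d \<and> Metric_space.mcomplete M d \<and>
     (\<forall>x\<in>M. \<forall>y\<in>M. \<exists>g. g \<in> {0..1} \<rightarrow> M \<and> g 0 = x \<and> g 1 = y \<and>
        (\<forall>s\<in>{0..1}. \<forall>t\<in>{0..1}. d (g s) (g t) = \<bar>s - t\<bar> * d x y))"


section \<open>Analysis on a metric space with carrier \<open>M\<close> and distance \<open>d\<close>\<close>

text \<open>Only the values of functions on the carrier \<open>M\<close> matter in what follows.\<close>

definition locally_Lipschitz :: "'a set \<Rightarrow> ('a \<Rightarrow> 'a \<Rightarrow> real) \<Rightarrow> ('a \<Rightarrow> real) \<Rightarrow> bool" where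
  "locally_Lipschitz M d u \<longleftrightarrow>
     (\<forall>x\<in>M. \<exists>r>0. \<exists>L. \<forall>y\<in>Metric_space.mball M d x r. \<forall>z\<in>Metric_space.mball M d x r.
        \<bar>u y - u z\<bar> \<le> L * d y z)"

text \<open>The filter \<open>atin\<close> is the punctured neighbourhood filter; it is \<open>bot\<close> exactly at isolated points.
  For locally Lipschitz functions the upper limits below are finite at all other points.\<close>

definition slope :: "'a set \<Rightarrow> ('a \<Rightarrow> 'a \<Rightarrow> real) \<Rightarrow> ('a \<Rightarrow> real) \<Rightarrow> 'a \<Rightarrow> real" where
  "slope M d u x =
     (if atin (Metric_space.mtopology M d) x = bot then 0
      else real_of_ereal (Limsup (atin (Metric_space.mtopology M d) x)
             (\<lambda>y. ereal (\<bar>u y - u x\<bar> / d x y))))"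

definition slope_plus :: "'a set \<Rightarrow> ('a \<Rightarrow> 'a \<Rightarrow> real) \<Rightarrow> ('a \<Rightarrow> real) \<Rightarrow> 'a \<Rightarrow> real" where
  "slope_plus M d u x =
     (if atin (Metric_space.mtopology M d) x = bot then 0
      else real_of_ereal (Limsup (atin (Metric_space.mtopology M d) x)
             (\<lambda>y. ereal (max (u y - u x) 0 / d x y))))"

definition slope_minus :: "'a set \<Rightarrow> ('a \<Rightarrow> 'a \<Rightarrow> real) \<Rightarrow> ('a \<Rightarrow> real) \<Rightarrow> 'a \<Rightarrow> real" where
  "slope_minus M d u x =
     (if atin (Metric_space.mtopology M d) x = bot then 0
      else real_of_ereal (Limsup (atin (Metric_space.mtopology M d) x)
             (\<lambda>y. ereal (max (- (u y - u x)) 0 / d x y))))"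

definition C1_plus :: "'a set \<Rightarrow> ('a \<Rightarrow> 'a \<Rightarrow> real) \<Rightarrow> ('a \<Rightarrow> real) \<Rightarrow> bool" where
  "C1_plus M d u \<longleftrightarrow> locally_Lipschitz M d u \<and>
     continuous_map (Metric_space.mtopology M d) euclideanreal (slope M d u) \<and>
     (\<forall>x\<in>M. slope_plus M d u x = slope M d u x)"

definition C1_minus :: "'a set \<Rightarrow> ('a \<Rightarrow> 'a \<Rightarrow> real) \<Rightarrow> ('a \<Rightarrow> real) \<Rightarrow> bool" where
  "C1_minus M d u \<longleftrightarrow> locally_Lipschitz M d u \<and>
     continuous_map (Metric_space.mtopology M d) euclideanreal (slope M d u) \<and>
     (\<forall>x\<in>M. slope_minus M d u x = slope M d u x)"

text \<open>The filter \<open>nhdsin\<close> is the full neighbourhood filter, so \<open>x\<close> itself is included in the limits: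
  \<open>usc_envelope M d u x\<close> is the infimum over \<open>r > 0\<close> of the supremum of \<open>u\<close> on the ball of radius
  \<open>r\<close> around \<open>x\<close>.\<close>

definition usc_envelope :: "'a set \<Rightarrow> ('a \<Rightarrow> 'a \<Rightarrow> real) \<Rightarrow> ('a \<Rightarrow> real) \<Rightarrow> 'a \<Rightarrow> ereal" where
  "usc_envelope M d u x = Limsup (nhdsin (Metric_space.mtopology M d) x) (\<lambda>y. ereal (u y))"

definition lsc_envelope :: "'a set \<Rightarrow> ('a \<Rightarrow> 'a \<Rightarrow> real) \<Rightarrow> ('a \<Rightarrow> real) \<Rightarrow> 'a \<Rightarrow> ereal" where
  "lsc_envelope M d u x = Liminf (nhdsin (Metric_space.mtopology M d) x) (\<lambda>y. ereal (u y))"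

definition upper_semicontinuous :: "'a set \<Rightarrow> ('a \<Rightarrow> 'a \<Rightarrow> real) \<Rightarrow> ('a \<Rightarrow> real) \<Rightarrow> bool" where
  "upper_semicontinuous M d u \<longleftrightarrow>
     (\<forall>a. openin (Metric_space.mtopology M d) {x \<in> M. u x < a})"

definition lower_semicontinuous :: "'a set \<Rightarrow> ('a \<Rightarrow> 'a \<Rightarrow> real) \<Rightarrow> ('a \<Rightarrow> real) \<Rightarrow> bool" where
  "lower_semicontinuous M d u \<longleftrightarrow>
     (\<forall>a. openin (Metric_space.mtopology M d) {x \<in> M. a < u x})"

definition local_max_at :: "'a set \<Rightarrow> ('a \<Rightarrow> 'a \<Rightarrow> real) \<Rightarrow> ('a \<Rightarrow> real) \<Rightarrow> 'a \<Rightarrow> bool" where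
  "local_max_at M d f x \<longleftrightarrow> x \<in> M \<and> (\<exists>r>0. \<forall>y\<in>Metric_space.mball M d x r. f y \<le> f x)"

definition local_min_at :: "'a set \<Rightarrow> ('a \<Rightarrow> 'a \<Rightarrow> real) \<Rightarrow> ('a \<Rightarrow> real) \<Rightarrow> 'a \<Rightarrow> bool" where
  "local_min_at M d f x \<longleftrightarrow> x \<in> M \<and> (\<exists>r>0. \<forall>y\<in>Metric_space.mball M d x r. f x \<le> f y)"


section \<open>Metric viscosity solutions\<close>

text \<open>No regularity of \<open>H\<close> is assumed, so the infimum and supremum may be infinite.\<close>

definition H_lower :: "('a \<Rightarrow> real \<Rightarrow> real \<Rightarrow> real) \<Rightarrow> real \<Rightarrow> 'a \<Rightarrow> real \<Rightarrow> real \<Rightarrow> ereal" where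
  "H_lower H a x u p = (INF p' \<in> {p'. p' \<ge> 0 \<and> \<bar>p' - p\<bar> \<le> a}. ereal (H x u p'))"

definition H_upper :: "('a \<Rightarrow> real \<Rightarrow> real \<Rightarrow> real) \<Rightarrow> real \<Rightarrow> 'a \<Rightarrow> real \<Rightarrow> real \<Rightarrow> ereal" where
  "H_upper H a x u p = (SUP p' \<in> {p'. p' \<ge> 0 \<and> \<bar>p' - p\<bar> \<le> a}. ereal (H x u p'))"

definition metric_viscosity_subsolution ::
  "'a set \<Rightarrow> ('a \<Rightarrow> 'a \<Rightarrow> real) \<Rightarrow> ('a \<Rightarrow> real \<Rightarrow> real \<Rightarrow> real) \<Rightarrow> ('a \<Rightarrow> real) \<Rightarrow> bool" where
  "metric_viscosity_subsolution M d H u \<longleftrightarrow>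
     (\<forall>x\<in>M. \<bar>usc_envelope M d u x\<bar> \<noteq> \<infinity>) \<and>
     (\<forall>\<psi>1 \<psi>2 x. C1_minus M d \<psi>1 \<and> locally_Lipschitz M d \<psi>2 \<and>
        local_max_at M d (\<lambda>y. real_of_ereal (usc_envelope M d u y) - (\<psi>1 y + \<psi>2 y)) x \<longrightarrow>
        H_lower H (real_of_ereal (usc_envelope M d (slope M d \<psi>2) x)) x
          (real_of_ereal (usc_envelope M d u x)) (slope M d \<psi>1 x) \<le> 0)"

definition metric_viscosity_supersolution ::
  "'a set \<Rightarrow> ('a \<Rightarrow> 'a \<Rightarrow> real) \<Rightarrow> ('a \<Rightarrow> real \<Rightarrow> real \<Rightarrow> real) \<Rightarrow> ('a \<Rightarrow> real) \<Rightarrow> bool" where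
  "metric_viscosity_supersolution M d H u \<longleftrightarrow>
     (\<forall>x\<in>M. \<bar>lsc_envelope M d u x\<bar> \<noteq> \<infinity>) \<and>
     (\<forall>\<psi>1 \<psi>2 x. C1_plus M d \<psi>1 \<and> locally_Lipschitz M d \<psi>2 \<and>
        local_min_at M d (\<lambda>y. real_of_ereal (lsc_envelope M d u y) - (\<psi>1 y + \<psi>2 y)) x \<longrightarrow>
        H_upper H (real_of_ereal (usc_envelope M d (slope M d \<psi>2) x)) x
          (real_of_ereal (lsc_envelope M d u x)) (slope M d \<psi>1 x) \<ge> 0)"


section \<open>Sequences of spaces and semilimits\<close>

text \<open>The index \<open>\<infinity> :: enat\<close> stands for the limit space.\<close>

definition approx_seqs :: "(enat \<Rightarrow> 'a::metric_space set) \<Rightarrow> 'a \<Rightarrow> (nat \<Rightarrow> 'a) set" where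
  "approx_seqs X x = {s. (\<forall>n. s n \<in> X (enat n)) \<and> s \<longlonglongrightarrow> x}"

definition upper_semilimit ::
  "(enat \<Rightarrow> 'a::metric_space set) \<Rightarrow> (nat \<Rightarrow> 'a \<Rightarrow> real) \<Rightarrow> 'a \<Rightarrow> ereal" where
  "upper_semilimit X u x = (SUP s \<in> approx_seqs X x. limsup (\<lambda>n. ereal (u n (s n))))"

definition lower_semilimit ::
  "(enat \<Rightarrow> 'a::metric_space set) \<Rightarrow> (nat \<Rightarrow> 'a \<Rightarrow> real) \<Rightarrow> 'a \<Rightarrow> ereal" where
  "lower_semilimit X u x = (INF s \<in> approx_seqs X x. liminf (\<lambda>n. ereal (u n (s n))))"

end

theory Submission
  imports Defs
begin

text \<open>
  The difficulty is that a test function on \<open>X\<^sub>\<infinity>\<close> cannot be transported to \<open>X\<^sub>n\<close>. It is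
  replaced by one built from distances to points. Let \<open>u - \<psi>\<^sub>1 - \<psi>\<^sub>2\<close> have a local maximum at \<open>x\<^sub>0\<close>, and let
  \<open>p\<close> and \<open>a\<close> be the slope of \<open>\<psi>\<^sub>1\<close> and the relaxed slope of \<open>\<psi>\<^sub>2\<close> there. Since the descending slope of
  \<open>\<psi>\<^sub>1\<close> at \<open>x\<^sub>0\<close> is \<open>p\<close>, some nearby \<open>y\<^sub>0\<close> has \<open>\<psi>\<^sub>1(x\<^sub>0) - \<psi>\<^sub>1(y\<^sub>0) \<approx> p d(x\<^sub>0,y\<^sub>0)\<close>, while \<open>\<psi>\<^sub>1\<close> is almost
  \<open>p\<close>-Lipschitz near \<open>x\<^sub>0\<close>. Hence \<open>\<psi>\<^sub>1(x) - \<psi>\<^sub>1(x\<^sub>0) \<le> p (d(x,y\<^sub>0) - d(x\<^sub>0,y\<^sub>0))\<close> up to a small error, and by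
  convexity of the square this is at most \<open>k d(x,y\<^sub>0)\<^sup>2 - k d(x\<^sub>0,y\<^sub>0)\<^sup>2\<close> with \<open>2 k d(x\<^sub>0,y\<^sub>0) = p\<close>; \<open>\<psi>\<^sub>2\<close> is
  replaced by \<open>(a + \<epsilon>) d(x,x\<^sub>0)\<close>. In any geodesic space \<open>k d(\<cdot>,y)\<^sup>2\<close> is \<open>C\<^sup>1\<^sup>,\<^sup>-\<close> with slope \<open>2 k d(\<cdot>,y)\<close>.

  The space \<open>(X\<^sub>n,d\<^sub>n)\<close> is complete but need not be compact, so the maximum on \<open>X\<^sub>n\<close> is produced by
  Ekeland's principle, whose penalty \<open>\<epsilon> d\<^sub>n(\<cdot>,z)\<close> is absorbed in the Lipschitz part of the test
  function. Compactness with respect to the ambient distance gives the uniform upper bounds that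
  place the maximum close to \<open>x\<^sub>0\<close>. Part (b) is part (a) for \<open>-u\<close> and \<open>-H(x,-u,p)\<close>.
\<close>

section \<open>Envelopes and slopes\<close>

lemma real_of_ereal_ge:
  assumes "ereal x \<le> a" "a \<le> ereal c"
  shows "x \<le> real_of_ereal a"
  using assms by (cases a) auto

text \<open>The value -\<infinity> is sent to 0 by \<open>real_of_ereal\<close>;
  \<open>0 \<le> c\<close> covers that case.\<close>

lemma real_of_ereal_le_nonneg:
  assumes "a \<le> ereal c" "0 \<le> c"
  shows "real_of_ereal a \<le> c"
  using assms by (cases a) auto

context Metric_space
begin

section \<open>Neighbourhood filters in terms of balls, and semicontinuous envelopes\<close>

lemma eventually_nhdsin_metric:
  assumes "x \<in> M"
  shows "eventually P (nhdsin mtopology x) \<longleftrightarrow> (\<exists>r>0. \<forall>y\<in>mball x r. P y)"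
proof
  assume "eventually P (nhdsin mtopology x)"
  then obtain S where "openin mtopology S" "x \<in> S" "\<forall>y\<in>S. P y"
    using assms by (auto simp: eventually_nhdsin)
  then show "\<exists>r>0. \<forall>y\<in>mball x r. P y"
    by (meson openin_mtopology subset_iff)
next
  assume "\<exists>r>0. \<forall>y\<in>mball x r. P y"
  then show "eventually P (nhdsin mtopology x)"
    using assms by (auto simp: eventually_nhdsin simp del: in_mball)
qed

lemma eventually_atin_mball:
  assumes "x \<in> M"
  shows "eventually P (atin mtopology x) \<longleftrightarrow> (\<exists>r>0. \<forall>y\<in>mball x r. y \<noteq> x \<longrightarrow> P y)"
  using assms by (auto simp: eventually_atin_metric commute)

lemma usc_envelope_lessD:
  assumes "x \<in> M" "usc_envelope M d u x < ereal c"
  shows "\<exists>r>0. \<forall>y\<in>mball x r. u y < c"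
  using Limsup_lessD[OF assms(2)[unfolded usc_envelope_def]] assms(1)
  by (simp only: eventually_nhdsin_metric less_ereal.simps)

lemma usc_envelope_le:
  assumes "x \<in> M" "r > 0" "\<And>y. y \<in> mball x r \<Longrightarrow> u y \<le> c"
  shows "usc_envelope M d u x \<le> ereal c"
  unfolding usc_envelope_def
  using assms by (intro Limsup_bounded) (auto simp: eventually_nhdsin_metric simp del: in_mball)

lemma le_usc_envelope:
  assumes "x \<in> M"
  shows "ereal (u x) \<le> usc_envelope M d u x"
proof (rule ccontr)
  assume "\<not> ?thesis"
  then have "usc_envelope M d u x < ereal (u x)" by simp
  from usc_envelope_lessD[OF assms this] show False
    using assms by (metis centre_in_mball_iff less_irrefl)
qed

lemma usc_envelope_gtD:
  assumes "x \<in> M" "ereal c < usc_envelope M d u x" "r > 0"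
  shows "\<exists>y\<in>mball x r. c < u y"
  using usc_envelope_le[OF assms(1,3), of u c] assms(2) by (meson not_le)

text \<open>A bound for \<open>u\<close> on a ball passes to the envelope at every point of that
  ball, since a smaller ball around the point still lies inside. Ekeland's principle needs this
  semicontinuity of the envelope.\<close>

lemma usc_envelope_usc:
  assumes fin: "\<And>y. y \<in> M \<Longrightarrow> \<bar>usc_envelope M d u y\<bar> \<noteq> \<infinity>"
    and x: "x \<in> M" and less: "real_of_ereal (usc_envelope M d u x) < c"
  shows "\<exists>r>0. \<forall>y\<in>mball x r. real_of_ereal (usc_envelope M d u y) < c"
proof -
  \<comment> \<open>The bound \<open>u < c'\<close> on a ball gives only \<open>\<le> c'\<close> for
    the envelope, so strictness needs room below \<open>c\<close>.\<close>
  obtain c' where c': "real_of_ereal (usc_envelope M d u x) < c'" "c' < c"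
    using dense less by blast
  have "usc_envelope M d u x < ereal c'"
    using c' fin[OF x] by (cases "usc_envelope M d u x") auto
  from usc_envelope_lessD[OF x this] obtain r where r: "r > 0" "\<forall>y\<in>mball x r. u y < c'"
    by blast
  have "real_of_ereal (usc_envelope M d u y) < c" if y: "y \<in> mball x r" for y
  proof -
    have yM: "y \<in> M" using y by simp
    have "\<exists>s>0. mball y s \<subseteq> mball x r"
      using y openin_mball by (meson openin_mtopology)
    then obtain s where "s > 0" "mball y s \<subseteq> mball x r" by blast
    then have "usc_envelope M d u y \<le> ereal c'"
      using r(2) by (intro usc_envelope_le[OF yM, of s]) (auto simp: less_imp_le subset_iff)
    then show ?thesis
      using c' fin[OF yM] by (cases "usc_envelope M d u y") auto
  qed
  with r(1) show ?thesis by blast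
qed

lemma usc_envelope_upper_semicontinuous:
  assumes "upper_semicontinuous M d u" "x \<in> M"
  shows "usc_envelope M d u x = ereal (u x)"
proof (rule antisym[OF _ le_usc_envelope[OF assms(2)]])
  show "usc_envelope M d u x \<le> ereal (u x)"
  proof (rule ereal_le_epsilon2)
    fix e :: real assume "e > 0"
    have "openin mtopology {y \<in> M. u y < u x + e}"
      using assms by (simp add: upper_semicontinuous_def)
    moreover have "x \<in> {y \<in> M. u y < u x + e}" using assms \<open>e > 0\<close> by simp
    ultimately obtain r where "r > 0" "mball x r \<subseteq> {y \<in> M. u y < u x + e}"
      by (meson openin_mtopology)
    then have "usc_envelope M d u x \<le> ereal (u x + e)"
      by (intro usc_envelope_le[OF assms(2), of r]) (auto simp: subset_iff less_imp_le)
    then show "usc_envelope M d u x \<le> ereal (u x) + ereal e" by simp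
  qed
qed

section \<open>Slopes and local Lipschitz bounds\<close>

lemma Limsup_atin_le:
  assumes "x \<in> M" "r > 0" "\<And>y. y \<in> mball x r \<Longrightarrow> y \<noteq> x \<Longrightarrow> q y \<le> c"
  shows "Limsup (atin mtopology x) (\<lambda>y. ereal (q y)) \<le> ereal c"
  using assms by (intro Limsup_bounded) (auto simp: eventually_atin_mball simp del: in_mball)

lemma slope_le:
  assumes "x \<in> M" "r > 0" "0 \<le> L" "\<And>y. y \<in> mball x r \<Longrightarrow> \<bar>u y - u x\<bar> \<le> L * d x y"
  shows "slope M d u x \<le> L"
proof -
  have "Limsup (atin mtopology x) (\<lambda>y. ereal (\<bar>u y - u x\<bar> / d x y)) \<le> ereal L"
    using assms by (intro Limsup_atin_le[of x r]) (auto simp: pos_divide_le_eq)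
  then show ?thesis
    using assms(3) by (auto simp: slope_def intro: real_of_ereal_le_nonneg)
qed

lemma slope_nonneg: "0 \<le> slope M d u x"
proof -
  have "0 \<le> Limsup (atin mtopology x) (\<lambda>y. ereal (\<bar>u y - u x\<bar> / d x y))"
    if "atin mtopology x \<noteq> bot"
    using that by (intro le_Limsup) auto
  then show ?thesis by (auto simp: slope_def real_of_ereal_pos)
qed

lemma locally_LipschitzD:
  assumes "locally_Lipschitz M d u" "x \<in> M"
  obtains r L where "r > 0" "L \<ge> 0"
    "\<And>y z. y \<in> mball x r \<Longrightarrow> z \<in> mball x r \<Longrightarrow> \<bar>u y - u z\<bar> \<le> L * d y z"
proof -
  obtain r L where r: "r > 0"
    "\<forall>y\<in>mball x r. \<forall>z\<in>mball x r. \<bar>u y - u z\<bar> \<le> L * d y z"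
    using assms unfolding locally_Lipschitz_def by blast
  have "L * d y z \<le> \<bar>L\<bar> * d y z" for y z
    by (intro mult_right_mono) auto
  with r(2) have "\<bar>u y - u z\<bar> \<le> \<bar>L\<bar> * d y z" if "y \<in> mball x r" "z \<in> mball x r" for y z
    using that by (meson order_trans)
  then show ?thesis using that[of r "\<bar>L\<bar>"] r(1) by simp
qed

lemma slope_bounded:
  assumes "locally_Lipschitz M d u" "x \<in> M"
  shows "\<exists>r>0. \<exists>L\<ge>0. \<forall>y\<in>mball x r. slope M d u y \<le> L"
proof -
  obtain r L where r: "r > 0" "L \<ge> 0"
    "\<And>y z. y \<in> mball x r \<Longrightarrow> z \<in> mball x r \<Longrightarrow> \<bar>u y - u z\<bar> \<le> L * d y z"
    using locally_LipschitzD[OF assms] by metis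
  have "slope M d u y \<le> L" if y: "y \<in> mball x r" for y
  proof -
    have "\<exists>s>0. mball y s \<subseteq> mball x r"
      using y openin_mball by (meson openin_mtopology)
    then obtain s where s: "s > 0" "mball y s \<subseteq> mball x r" by blast
    have "\<bar>u z - u y\<bar> \<le> L * d y z" if "z \<in> mball y s" for z
      using r(3)[of y z] y that s(2) by (simp add: abs_minus_commute subset_iff)
    then show ?thesis
      using y r(2) s(1) by (intro slope_le[of y s]) auto
  qed
  with r show ?thesis by blast
qed

lemma slope_lessD:
  assumes "locally_Lipschitz M d u" "x \<in> M" "slope M d u x < c"
  shows "\<exists>r>0. \<forall>y\<in>mball x r. \<bar>u y - u x\<bar> \<le> c * d x y"
proof (cases "atin mtopology x = bot")
  \<comment> \<open>At an isolated point a small ball contains only \<open>x\<close>, where both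
    sides vanish.\<close>
  case True
  then have "eventually (\<lambda>y. False) (atin mtopology x)" by simp
  then obtain r where "r > 0" "\<forall>y\<in>mball x r. y = x"
    using assms(2) by (auto simp: eventually_atin_mball simp del: in_mball)
  then show ?thesis using assms(2) by (intro exI[of _ r]) auto
next
  case False
  let ?L = "Limsup (atin mtopology x) (\<lambda>y. ereal (\<bar>u y - u x\<bar> / d x y))"
  obtain r L where r: "r > 0" "L \<ge> 0"
    "\<And>y z. y \<in> mball x r \<Longrightarrow> z \<in> mball x r \<Longrightarrow> \<bar>u y - u z\<bar> \<le> L * d y z"
    using locally_LipschitzD[OF assms(1,2)] by metis
  \<comment> \<open>The two bounds make the upper limit finite, so that \<open>slope\<close> is this
    limit and not the default value of \<open>real_of_ereal\<close>.\<close>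
  have "?L \<le> ereal L"
    using assms(2) r(1) r(3)[of _ x]
    by (intro Limsup_atin_le[of x r]) (auto simp: pos_divide_le_eq commute)
  moreover have "0 \<le> ?L"
    using False by (intro le_Limsup) auto
  ultimately have "?L < ereal c"
    using assms(3) False by (cases ?L) (auto simp: slope_def)
  from Limsup_lessD[OF this] obtain s where s: "s > 0"
    "\<forall>y\<in>mball x s. y \<noteq> x \<longrightarrow> \<bar>u y - u x\<bar> / d x y < c"
    using assms(2) by (auto simp: eventually_atin_mball simp del: in_mball)
  have "\<bar>u y - u x\<bar> \<le> c * d x y" if "y \<in> mball x s" for y
    using that s(2) assms(2) by (cases "y = x") (auto simp: pos_divide_less_eq less_imp_le)
  with s(1) show ?thesis by blast
qed

text \<open>If no such point existed, all difference quotients near \<open>x\<close> would be at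
  most \<open>s\<close>. Here \<open>0 \<le> s\<close> takes care of the positive part and of the
  default value 0 at isolated points.\<close>

lemma slope_minus_gtD:
  assumes "x \<in> M" "0 \<le> s" "s < slope_minus M d u x" "r > 0"
  shows "\<exists>y\<in>mball x r. y \<noteq> x \<and> s * d x y < u x - u y"
proof (rule ccontr)
  assume *: "\<not> ?thesis"
  have "Limsup (atin mtopology x) (\<lambda>y. ereal (max (- (u y - u x)) 0 / d x y)) \<le> ereal s"
    using assms * by (intro Limsup_atin_le[of x r]) (auto simp: pos_divide_le_eq not_less)
  then have "slope_minus M d u x \<le> s"
    using assms(2) by (auto simp: slope_minus_def intro: real_of_ereal_le_nonneg)
  with assms(3) show False by simp
qed

text \<open>The slope of a locally Lipschitz function is locally bounded, so its envelope is finite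
  and taking the real value loses nothing.\<close>

lemma slope_usc_envelope:
  assumes "locally_Lipschitz M d u" "x \<in> M"
  shows "slope M d u x \<le> real_of_ereal (usc_envelope M d (slope M d u) x)"
proof -
  obtain r L where r: "r > 0" "L \<ge> 0" "\<forall>y\<in>mball x r. slope M d u y \<le> L"
    using slope_bounded[OF assms] by blast
  have "usc_envelope M d (slope M d u) x \<le> ereal L"
    using r by (intro usc_envelope_le[OF assms(2) r(1)]) auto
  moreover have "ereal (slope M d u x) \<le> usc_envelope M d (slope M d u) x"
    by (rule le_usc_envelope[OF assms(2)])
  ultimately show ?thesis by (rule real_of_ereal_ge[rotated])
qed

lemma locally_Lipschitz_close:
  assumes "locally_Lipschitz M d u" "x \<in> M" "e > 0"
  shows "\<exists>r>0. \<forall>y\<in>mball x r. \<bar>u y - u x\<bar> < e"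
proof -
  obtain r L where r: "r > 0" "L \<ge> 0"
    "\<And>y z. y \<in> mball x r \<Longrightarrow> z \<in> mball x r \<Longrightarrow> \<bar>u y - u z\<bar> \<le> L * d y z"
    using locally_LipschitzD[OF assms(1,2)] by metis
  have "\<bar>u y - u x\<bar> < e" if y: "y \<in> mball x (min r (e / (L + 1)))" for y
  proof -
    have "\<bar>u y - u x\<bar> \<le> L * d x y"
      using r(1) r(3)[of y x] y assms(2) commute[of x y] by simp
    also have "\<dots> \<le> d x y * (L + 1)" by (simp add: algebra_simps)
    also have "\<dots> < e" using y r(2) by (simp add: pos_less_divide_eq)
    finally show ?thesis .
  qed
  moreover have "0 < min r (e / (L + 1))" using r(1,2) assms(3) by simp
  ultimately show ?thesis by blast
qed

section \<open>Combinations of two distance functions, the Lipschitz parts of the test functions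
  used later\<close>

lemma dist_combination_Lipschitz:
  assumes "x1 \<in> M" "x2 \<in> M" "0 \<le> b" "0 \<le> c" "y \<in> M" "z \<in> M"
  shows "\<bar>(b * d y x1 + c * d y x2) - (b * d z x1 + c * d z x2)\<bar> \<le> (b + c) * d y z"
proof -
  have "\<bar>d y x1 - d z x1\<bar> \<le> d y z" "\<bar>d y x2 - d z x2\<bar> \<le> d y z"
    using mdist_reverse_triangle[of y x1 z] mdist_reverse_triangle[of y x2 z] assms
      commute[of x1 z] commute[of x2 z] by auto
  then have "b * \<bar>d y x1 - d z x1\<bar> \<le> b * d y z" "c * \<bar>d y x2 - d z x2\<bar> \<le> c * d y z"
    using assms by (auto intro: mult_left_mono)
  then have "\<bar>b * (d y x1 - d z x1)\<bar> \<le> b * d y z" "\<bar>c * (d y x2 - d z x2)\<bar> \<le> c * d y z"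
    using assms by (auto simp: abs_mult)
  moreover have "(b * d y x1 + c * d y x2) - (b * d z x1 + c * d z x2) =
      b * (d y x1 - d z x1) + c * (d y x2 - d z x2)"
    "(b + c) * d y z = b * d y z + c * d y z" by (simp_all add: algebra_simps)
  ultimately show ?thesis by linarith
qed

lemma dist_combination_locally_Lipschitz:
  assumes "x1 \<in> M" "x2 \<in> M" "0 \<le> b" "0 \<le> c"
  shows "locally_Lipschitz M d (\<lambda>y. b * d y x1 + c * d y x2)"
  unfolding locally_Lipschitz_def
proof
  fix x
  have "\<forall>y\<in>mball x 1. \<forall>z\<in>mball x 1.
      \<bar>(b * d y x1 + c * d y x2) - (b * d z x1 + c * d z x2)\<bar> \<le> (b + c) * d y z"
    using dist_combination_Lipschitz[OF assms] by simp
  then show "\<exists>r>0. \<exists>L. \<forall>y\<in>mball x r. \<forall>z\<in>mball x r.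
      \<bar>(b * d y x1 + c * d y x2) - (b * d z x1 + c * d z x2)\<bar> \<le> L * d y z"
    by (meson zero_less_one)
qed

text \<open>The slope is bounded by \<open>b + c\<close> at every point, hence so is its envelope.
  This will bound the radius of the modified Hamiltonian.\<close>

lemma dist_combination_slope_le:
  assumes "x1 \<in> M" "x2 \<in> M" "0 \<le> b" "0 \<le> c" "x \<in> M"
  shows "real_of_ereal (usc_envelope M d (slope M d (\<lambda>y. b * d y x1 + c * d y x2)) x) \<le> b + c"
proof (rule real_of_ereal_le_nonneg[OF usc_envelope_le[OF \<open>x \<in> M\<close> zero_less_one]])
  show "0 \<le> b + c" using assms by simp
  fix y assume y: "y \<in> mball x 1"
  show "slope M d (\<lambda>y. b * d y x1 + c * d y x2) y \<le> b + c"
  proof (rule slope_le[of y 1])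
    fix z assume z: "z \<in> mball y 1"
    then show "\<bar>(b * d z x1 + c * d z x2) - (b * d y x1 + c * d y x2)\<bar> \<le> (b + c) * d y z"
      using dist_combination_Lipschitz[OF assms(1-4), of z y] commute[of y z] by simp
  qed (use y assms in auto)
qed

end

section \<open>Geodesic spaces\<close>

text \<open>Bisection: the estimate over \<open>[a, b]\<close> adds up when intervals are joined,
  and it holds on every short interval around a point \<open>x\<close> by comparing both ends with
  \<open>x\<close>. The hypothesis compares values only with the value at the centre
  \<open>t\<close>.\<close>

lemma local_Lipschitz_bound_interval:
  fixes h :: "real \<Rightarrow> real"
  assumes "\<And>t. t \<in> {0..1} \<Longrightarrow> \<exists>r>0. \<forall>s\<in>{0..1}. \<bar>s - t\<bar> < r \<longrightarrow> \<bar>h s - h t\<bar> \<le> L * \<bar>s - t\<bar>"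
  shows "\<bar>h 1 - h 0\<bar> \<le> L"
proof -
  define P where "P a b \<longleftrightarrow> (0 \<le> a \<and> b \<le> 1 \<longrightarrow> \<bar>h b - h a\<bar> \<le> L * (b - a))" for a b
  have "(0::real) \<le> 1" by simp
  then have "P 0 1"
  proof (induction rule: Bolzano)
    case (trans a b c)
    show ?case
      unfolding P_def
    proof
      assume "0 \<le> a \<and> c \<le> 1"
      then have "\<bar>h b - h a\<bar> \<le> L * (b - a)" "\<bar>h c - h b\<bar> \<le> L * (c - b)"
        using trans by (auto simp: P_def)
      then have "\<bar>h c - h a\<bar> \<le> L * (b - a) + L * (c - b)" by linarith
      also have "\<dots> = L * (c - a)" by (simp add: algebra_simps)
      finally show "\<bar>h c - h a\<bar> \<le> L * (c - a)" .
    qed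
  next
    case (local x)
    then obtain r where r: "r > 0"
      "\<And>s. s \<in> {0..1} \<Longrightarrow> \<bar>s - x\<bar> < r \<Longrightarrow> \<bar>h s - h x\<bar> \<le> L * \<bar>s - x\<bar>"
      using assms[of x] by auto
    have "P a b" if ab: "a \<le> x" "x \<le> b" "b - a < r" for a b
      unfolding P_def
    proof
      assume "0 \<le> a \<and> b \<le> 1"
      then have "\<bar>h a - h x\<bar> \<le> L * (x - a)" "\<bar>h b - h x\<bar> \<le> L * (b - x)"
        using r(2)[of a] r(2)[of b] ab local by auto
      then have "\<bar>h b - h a\<bar> \<le> L * (b - x) + L * (x - a)" by linarith
      also have "\<dots> = L * (b - a)" by (simp add: algebra_simps)
      finally show "\<bar>h b - h a\<bar> \<le> L * (b - a)" .
    qed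
    with r(1) show ?case by blast
  qed
  then show ?thesis by (simp add: P_def)
qed

locale geodesic_metric_space = Metric_space +
  assumes mcomplete: "mcomplete"
    and geodesic: "\<And>x y. x \<in> M \<Longrightarrow> y \<in> M \<Longrightarrow> \<exists>g. g \<in> {0..1::real} \<rightarrow> M \<and> g 0 = x \<and> g 1 = y \<and>
        (\<forall>s\<in>{0..1}. \<forall>t\<in>{0..1}. d (g s) (g t) = \<bar>s - t\<bar> * d x y)"

lemma geodesic_metric_space_iff:
  "geodesic_metric_space M d \<longleftrightarrow> complete_geodesic_space M d"
  unfolding complete_geodesic_space_def geodesic_metric_space_def geodesic_metric_space_axioms_def
  by blast

section \<open>Slope bounds along geodesics, squared distances and quadratic test functions\<close>

context geodesic_metric_space
begin

text \<open>The slope bound is integrated along a geodesic from \<open>x\<close> to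
  \<open>y\<close>. The radius is halved to keep the geodesic in the ball of radius
  \<open>r\<close>: each of its points is within half its length, so less than \<open>r/2\<close>,
  of one endpoint.\<close>

lemma Lipschitz_of_slope_less:
  assumes lip: "locally_Lipschitz M d u" and x0: "x0 \<in> M"
    and slope: "\<And>z. z \<in> mball x0 r \<Longrightarrow> slope M d u z < c"
    and x: "x \<in> mball x0 (r/2)" and y: "y \<in> mball x0 (r/2)"
  shows "\<bar>u y - u x\<bar> \<le> c * d x y"
proof -
  have xy: "x \<in> M" "y \<in> M" using x y by auto
  obtain g where g: "g \<in> {0..1::real} \<rightarrow> M" "g 0 = x" "g 1 = y"
    "\<And>s t. s \<in> {0..1} \<Longrightarrow> t \<in> {0..1} \<Longrightarrow> d (g s) (g t) = \<bar>s - t\<bar> * d x y"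
    using geodesic[OF xy] by blast
  have dxy: "d x y < r" using triangle[of x x0 y] x y x0 commute[of x x0] by simp
  have gball: "g t \<in> mball x0 r" if t: "t \<in> {0..1}" for t
  proof -
    have gt: "g t \<in> M" using g t by auto
    have "d x0 (g t) < r"
    proof (cases "t \<le> 1/2")
      case True
      have "d x (g t) = t * d x y" using g(4)[of 0 t] g(2) t by simp
      also have "\<dots> \<le> 1/2 * d x y" using True by (intro mult_right_mono) auto
      finally show ?thesis using triangle[of x0 x "g t"] x xy gt dxy by simp
    next
      case False
      have "d y (g t) = (1 - t) * d x y" using g(4)[of 1 t] g(3) t by simp
      also have "\<dots> \<le> 1/2 * d x y" using False by (intro mult_right_mono) auto
      finally show ?thesis using triangle[of x0 y "g t"] y xy gt dxy by simp
    qed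
    then show ?thesis using x0 gt by simp
  qed
  have "\<bar>u (g 1) - u (g 0)\<bar> \<le> c * d x y"
  proof (rule local_Lipschitz_bound_interval)
    fix t :: real assume t: "t \<in> {0..1}"
    have gt: "g t \<in> M" using g t by auto
    obtain e where e: "e > 0" "\<forall>z\<in>mball (g t) e. \<bar>u z - u (g t)\<bar> \<le> c * d (g t) z"
      using slope_lessD[OF lip gt slope[OF gball[OF t]]] by blast
    \<comment> \<open>The summand 1 in the denominator below allows \<open>x = y\<close>.\<close>
    have "\<bar>u (g s) - u (g t)\<bar> \<le> c * d x y * \<bar>s - t\<bar>"
      if s: "s \<in> {0..1}" "\<bar>s - t\<bar> < e / (d x y + 1)" for s
    proof -
      have "\<bar>s - t\<bar> * d x y \<le> \<bar>s - t\<bar> * (d x y + 1)" by (intro mult_left_mono) auto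
      also have "\<dots> < e" using s(2) by (simp add: pos_less_divide_eq add_nonneg_pos)
      finally have "d (g t) (g s) < e" using g(4)[OF t s(1)] by (simp add: abs_minus_commute)
      then have "\<bar>u (g s) - u (g t)\<bar> \<le> c * d (g t) (g s)"
        using e(2) gt funcset_mem[OF g(1) s(1)] by simp
      then show ?thesis using g(4)[OF t s(1)] by (simp add: abs_minus_commute mult_ac)
    qed
    moreover have "e / (d x y + 1) > 0" using e(1) by (simp add: add_nonneg_pos)
    ultimately show "\<exists>r>0. \<forall>s\<in>{0..1}. \<bar>s - t\<bar> < r \<longrightarrow> \<bar>u (g s) - u (g t)\<bar> \<le> c * d x y * \<bar>s - t\<bar>"
      by blast
  qed
  then show ?thesis using g by simp
qed

text \<open>The upper bound comes from factoring the difference of squares. The lower bound for the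
  descending slope comes from moving towards \<open>y0\<close> along a geodesic, where the distance
  to \<open>y0\<close> decreases at unit rate.\<close>

lemma sq_dist_slopes:
  assumes y0: "y0 \<in> M" and k: "0 \<le> k" and x: "x \<in> M"
  shows "slope M d (\<lambda>y. k * (d y y0)\<^sup>2) x = 2 * k * d x y0"
    and "slope_minus M d (\<lambda>y. k * (d y y0)\<^sup>2) x = 2 * k * d x y0"
proof -
  define D where "D = d x y0"
  define q where "q y = \<bar>k * (d y y0)\<^sup>2 - k * D\<^sup>2\<bar> / d x y" for y
  define qm where "qm y = max (- (k * (d y y0)\<^sup>2 - k * D\<^sup>2)) 0 / d x y" for y
  let ?F = "atin mtopology x"
  have D0: "D \<ge> 0" by (simp add: D_def)
  have upper: "Limsup ?F (\<lambda>y. ereal (q y)) \<le> ereal (2 * k * D)"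
  proof (rule ereal_le_epsilon2)
    fix e :: real assume e: "e > 0"
    have "Limsup ?F (\<lambda>y. ereal (q y)) \<le> ereal (2 * k * D + e)"
    proof (rule Limsup_atin_le[OF x, of "e / (k + 1)"])
      show "0 < e / (k + 1)" using e k by simp
      fix y assume y: "y \<in> mball x (e / (k + 1))" "y \<noteq> x"
      then have yM: "y \<in> M" and pos: "d x y > 0" using x by auto
      have ke: "k * d x y \<le> e"
      proof -
        have "d x y * (k + 1) < e" using y(1) k by (simp add: pos_less_divide_eq)
        then show ?thesis using pos by (simp add: algebra_simps)
      qed
      have t: "\<bar>d y y0 - D\<bar> \<le> d x y"
        using mdist_reverse_triangle[OF yM y0 x] by (simp add: D_def commute)
      have sumle: "d y y0 + D \<le> 2 * D + d x y" using t by linarith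
      have "\<bar>k * (d y y0)\<^sup>2 - k * D\<^sup>2\<bar> = k * (\<bar>d y y0 - D\<bar> * (d y y0 + D))"
      proof -
        have "k * (d y y0)\<^sup>2 - k * D\<^sup>2 = k * ((d y y0 - D) * (d y y0 + D))"
          by (simp add: power2_eq_square algebra_simps)
        then show ?thesis using k D0 by (simp add: abs_mult)
      qed
      also have "\<dots> \<le> k * (d x y * (2 * D + d x y))"
        using t sumle k D0 by (intro mult_left_mono mult_mono) auto
      also have "\<dots> = (2 * k * D + k * d x y) * d x y" by (simp add: algebra_simps)
      also have "\<dots> \<le> (2 * k * D + e) * d x y"
        using ke by (intro mult_right_mono) auto
      finally show "q y \<le> 2 * k * D + e"
        using pos by (simp add: q_def pos_divide_le_eq)
    qed
    then show "Limsup ?F (\<lambda>y. ereal (q y)) \<le> ereal (2 * k * D) + ereal e" by simp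
  qed
  have mono: "Limsup ?F (\<lambda>y. ereal (qm y)) \<le> Limsup ?F (\<lambda>y. ereal (q y))"
    by (intro Limsup_mono always_eventually) (auto simp: q_def qm_def intro!: divide_right_mono)
  have lower: "ereal (2 * k * D) \<le> Limsup ?F (\<lambda>y. ereal (qm y))" if "D > 0"
  proof (rule ccontr)
    assume "\<not> ?thesis"
    then have "Limsup ?F (\<lambda>y. ereal (qm y)) < ereal (2 * k * D)" by simp
    then obtain C where C: "Limsup ?F (\<lambda>y. ereal (qm y)) < ereal C" "C < 2 * k * D"
      by (metis less_ereal.simps(1) ereal_dense2)
    from Limsup_lessD[OF C(1)] obtain r where r: "r > 0"
      "\<forall>y\<in>mball x r. y \<noteq> x \<longrightarrow> qm y < C"
      using x by (auto simp: eventually_atin_mball simp del: in_mball)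
    obtain g where g: "g \<in> {0..1::real} \<rightarrow> M" "g 0 = x" "g 1 = y0"
      "\<And>s t. s \<in> {0..1} \<Longrightarrow> t \<in> {0..1} \<Longrightarrow> d (g s) (g t) = \<bar>s - t\<bar> * d x y0"
      using geodesic[OF x y0] by blast
    \<comment> \<open>The three bounds keep \<open>g t\<close> on the geodesic, keep it in the ball
      of radius \<open>r\<close>, and make the quotient \<open>k * D * (2 - t)\<close> exceed
      \<open>C\<close>.\<close>
    define t where "t = Min {1, r / (2 * D), (2 * k * D - C) / (k * D + 1)}"
    have kD: "k * D + 1 > 0" using k D0 by (simp add: add_nonneg_pos)
    have t: "t > 0" "t \<le> 1" "t \<le> r / (2 * D)" "t \<le> (2 * k * D - C) / (k * D + 1)"
      using r(1) that C(2) kD by (auto simp: t_def)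
    have d1: "d x (g t) = t * D" using g(4)[of 0 t] t g(2) by (simp add: D_def)
    have d2: "d (g t) y0 = (1 - t) * D" using g(4)[of t 1] t g(3) by (simp add: D_def)
    have gM: "g t \<in> M" using g(1) t by auto
    have "t * D \<le> r / 2" using t(3) that by (simp add: field_simps)
    then have "g t \<in> mball x r" using d1 gM x r(1) by simp
    moreover have "g t \<noteq> x" using d1 t that x by force
    ultimately have "qm (g t) < C" using r(2) by blast
    moreover have "qm (g t) \<ge> k * D * (2 - t)"
    proof -
      have "(- (k * (d (g t) y0)\<^sup>2 - k * D\<^sup>2)) = k * D * (2 - t) * (t * D)"
        unfolding d2 by (simp add: power2_eq_square algebra_simps)
      then show ?thesis unfolding qm_def d1 using t that by (simp add: pos_le_divide_eq)
    qed
    moreover have "t * (k * D + 1) \<le> 2 * k * D - C"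
      using t(4) kD by (simp add: pos_le_divide_eq)
    then have "C \<le> k * D * (2 - t) - t" by (simp add: algebra_simps)
    ultimately show False using t(1) by linarith
  qed
  have nn: "0 \<le> Limsup ?F (\<lambda>y. ereal (qm y))" if "?F \<noteq> bot"
    using that by (intro le_Limsup always_eventually) (auto simp: qm_def)
  \<comment> \<open>Over the trivial filter the upper limit is -\<infinity>, which contradicts
    \<open>lower\<close> if \<open>D > 0\<close>. So the default slope 0 at an isolated point agrees
    with the formula.\<close>
  have bot: "D = 0" if "?F = bot"
  proof (rule ccontr)
    assume "D \<noteq> 0"
    then have "ereal (2 * k * D) \<le> bot" using lower D0 that by simp
    then show False by (simp add: bot_ereal_def)
  qed
  have eq: "Limsup ?F (\<lambda>y. ereal (q y)) = ereal (2 * k * D) \<and>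
       Limsup ?F (\<lambda>y. ereal (qm y)) = ereal (2 * k * D)" if "?F \<noteq> bot"
  proof -
    have "ereal (2 * k * D) \<le> Limsup ?F (\<lambda>y. ereal (qm y))"
    proof (cases "D = 0")
      case True
      with nn[OF that] show ?thesis by (simp only: mult_zero_right zero_ereal_def)
    next
      case False
      with D0 show ?thesis by (intro lower) simp
    qed
    with upper mono show ?thesis by (meson antisym order_trans)
  qed
  have "slope M d (\<lambda>y. k * (d y y0)\<^sup>2) x = 2 * k * D \<and>
      slope_minus M d (\<lambda>y. k * (d y y0)\<^sup>2) x = 2 * k * D"
  proof (cases "?F = bot")
    case True
    then show ?thesis by (simp add: slope_def slope_minus_def bot)
  next
    case False
    from eq[OF this, unfolded q_def qm_def D_def] False show ?thesis
      unfolding slope_def slope_minus_def D_def by (simp only: if_False real_of_ereal.simps)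
  qed
  then show "slope M d (\<lambda>y. k * (d y y0)\<^sup>2) x = 2 * k * d x y0"
    "slope_minus M d (\<lambda>y. k * (d y y0)\<^sup>2) x = 2 * k * d x y0"
    by (simp_all only: D_def)
qed

lemma C1_minus_sq_dist:
  assumes y0: "y0 \<in> M" and k: "0 \<le> k"
  shows "C1_minus M d (\<lambda>y. k * (d y y0)\<^sup>2)"
  unfolding C1_minus_def
proof (intro conjI ballI)
  show "locally_Lipschitz M d (\<lambda>y. k * (d y y0)\<^sup>2)"
    unfolding locally_Lipschitz_def
  proof
    fix x assume x: "x \<in> M"
    have "\<bar>k * (d y y0)\<^sup>2 - k * (d z y0)\<^sup>2\<bar> \<le> (k * (2 * d x y0 + 2)) * d y z"
      if y: "y \<in> mball x 1" and z: "z \<in> mball x 1" for y z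
    proof -
      have *: "\<bar>d y y0 - d z y0\<bar> \<le> d y z" "d y y0 \<le> d x y0 + 1" "d z y0 \<le> d x y0 + 1"
        using mdist_reverse_triangle[of y y0 z] triangle[of y x y0] triangle[of z x y0]
          x y z y0 commute[of y x] commute[of z x] commute[of y0 z] by auto
      have "k * (d y y0)\<^sup>2 - k * (d z y0)\<^sup>2 = k * ((d y y0 - d z y0) * (d y y0 + d z y0))"
        by (simp add: power2_eq_square algebra_simps)
      then have "\<bar>k * (d y y0)\<^sup>2 - k * (d z y0)\<^sup>2\<bar> = k * (\<bar>d y y0 - d z y0\<bar> * (d y y0 + d z y0))"
        using k by (simp add: abs_mult)
      also have "\<dots> \<le> k * (d y z * (2 * d x y0 + 2))"
        using * k by (intro mult_left_mono mult_mono) auto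
      finally show ?thesis by (simp add: algebra_simps)
    qed
    then show "\<exists>r>0. \<exists>L. \<forall>y\<in>mball x r. \<forall>z\<in>mball x r.
        \<bar>k * (d y y0)\<^sup>2 - k * (d z y0)\<^sup>2\<bar> \<le> L * d y z"
      by (meson zero_less_one)
  qed
  have "continuous_map mtopology euclideanreal (\<lambda>x. 2 * k * d x y0)"
    unfolding Met_TC.continuous_map_to_metric[unfolded mtopology_is_euclidean mball_eq_ball]
  proof (intro ballI allI impI)
    fix x and e :: real assume "x \<in> topspace mtopology" and e: "e > 0"
    then have x: "x \<in> M" by simp
    have "2 * k * d y y0 \<in> ball (2 * k * d x y0) e" if y: "y \<in> mball x (e / (2 * k + 1))" for y
    proof -
      have yM: "y \<in> M" using y by simp
      have "\<bar>2 * k * d x y0 - 2 * k * d y y0\<bar> = 2 * k * \<bar>d x y0 - d y y0\<bar>"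
        using k by (simp add: abs_mult flip: right_diff_distrib)
      also have "\<dots> \<le> 2 * k * d x y"
        using mdist_reverse_triangle[OF x y0 yM] k commute[of y0 y] by (intro mult_left_mono) auto
      also have "\<dots> \<le> d x y * (2 * k + 1)" by (simp add: algebra_simps)
      also have "\<dots> < e" using y k by (simp add: pos_less_divide_eq)
      finally show ?thesis by (simp add: dist_real_def)
    qed
    moreover have "0 < e / (2 * k + 1)" using e k by simp
    ultimately show "\<exists>U. openin mtopology U \<and> x \<in> U \<and>
        (\<forall>y\<in>U. 2 * k * d y y0 \<in> ball (2 * k * d x y0) e)"
      using x by (meson centre_in_mball_iff openin_mball)
  qed
  then show "continuous_map mtopology euclideanreal (slope M d (\<lambda>y. k * (d y y0)\<^sup>2))"
    by (rule continuous_map_eq) (simp add: sq_dist_slopes[OF y0 k])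
  fix x assume "x \<in> M"
  then show "slope_minus M d (\<lambda>y. k * (d y y0)\<^sup>2) x = slope M d (\<lambda>y. k * (d y y0)\<^sup>2) x"
    by (simp add: sq_dist_slopes[OF y0 k])
qed

text \<open>The bound \<open>2 * k * rho \<le> p * alpha\<close> limits the variation of the slope
  of the quadratic over the ball of radius \<open>rho\<close> to \<open>p * alpha\<close>. The error
  \<open>alpha * rho / 8\<close> is small compared with what an additional penalty
  \<open>alpha * d x0 x\<close> gains at distances of order \<open>rho\<close>.\<close>

lemma touching_quadratic:
  assumes psi1: "C1_minus M d psi1" and psi2: "locally_Lipschitz M d psi2"
    and max: "local_max_at M d (\<lambda>y. U y - (psi1 y + psi2 y)) x0"
    and alpha: "0 < alpha" "alpha \<le> 1" and delta: "0 < delta"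
  defines "p \<equiv> slope M d psi1 x0"
    and "a \<equiv> real_of_ereal (usc_envelope M d (slope M d psi2) x0)"
  obtains y0 k rho where "y0 \<in> M" "0 \<le> k" "0 < rho" "rho \<le> delta"
    "2 * k * d x0 y0 = p" "2 * k * rho \<le> p * alpha"
    "\<And>x. x \<in> mcball x0 rho \<Longrightarrow>
       U x - U x0 \<le> k * ((d x y0)\<^sup>2 - (d x0 y0)\<^sup>2) + (a + alpha) * d x0 x + alpha * rho / 8"
proof -
  have x0: "x0 \<in> M" using max by (simp add: local_max_at_def)
  have lip1: "locally_Lipschitz M d psi1"
    and cont: "continuous_map mtopology euclideanreal (slope M d psi1)"
    and minus: "slope_minus M d psi1 x0 = p"
    using psi1 x0 by (auto simp: C1_minus_def p_def)
  obtain r1 where r1: "r1 > 0" "\<And>y. y \<in> mball x0 r1 \<Longrightarrow> U y - (psi1 y + psi2 y) \<le> U x0 - (psi1 x0 + psi2 x0)"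
    using max by (auto simp: local_max_at_def)
  have "slope M d psi2 x0 < a + alpha / 2"
    using slope_usc_envelope[OF psi2 x0] alpha by (simp add: a_def)
  from slope_lessD[OF psi2 x0 this] obtain r2 where r2: "r2 > 0"
    "\<And>y. y \<in> mball x0 r2 \<Longrightarrow> \<bar>psi2 y - psi2 x0\<bar> \<le> (a + alpha / 2) * d x0 y"
    by blast
  have p0: "p \<ge> 0" by (simp add: p_def slope_nonneg)
  show ?thesis
  proof (cases "p = 0")
    \<comment> \<open>With slope 0 there is no direction of descent; \<open>psi1\<close> is absorbed
      in the linear term, and the quadratic is zero.\<close>
    case True
    then have "slope M d psi1 x0 < alpha / 2" using alpha by (simp add: p_def)
    from slope_lessD[OF lip1 x0 this] obtain r3 where r3: "r3 > 0"
      "\<And>y. y \<in> mball x0 r3 \<Longrightarrow> \<bar>psi1 y - psi1 x0\<bar> \<le> alpha / 2 * d x0 y"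
      by blast
    define rho where "rho = Min {r1 / 2, r2 / 2, r3 / 2, delta}"
    have rho: "rho > 0" "rho < r1" "rho < r2" "rho < r3" "rho \<le> delta"
      using r1 r2 r3 delta by (auto simp: rho_def min_def)
    have "U x - U x0 \<le> (a + alpha) * d x0 x + alpha * rho / 8" if "x \<in> mcball x0 rho" for x
    proof -
      have "0 \<le> alpha * rho / 8" using alpha rho by simp
      moreover have "\<bar>psi2 x - psi2 x0\<bar> + \<bar>psi1 x - psi1 x0\<bar> \<le> (a + alpha / 2) * d x0 x + alpha / 2 * d x0 x"
        using that rho by (intro add_mono r2(2) r3(2)) auto
      moreover have "U x - (psi1 x + psi2 x) \<le> U x0 - (psi1 x0 + psi2 x0)"
        using that rho by (intro r1(2)) auto
      moreover have "(a + alpha / 2) * d x0 x + alpha / 2 * d x0 x = (a + alpha) * d x0 x"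
        by (simp add: algebra_simps)
      ultimately show ?thesis by linarith
    qed
    with True p0 alpha rho x0 show ?thesis by (intro that[of x0 0 rho]) auto
  next
    case False
    with p0 have p: "p > 0" by simp
    \<comment> \<open>The first bound gives
      \<open>eps * (D + t) \<le> 3 * eps * D \<le> alpha * rho / 8\<close>; the second keeps the
      descent rate \<open>p - eps\<close> nonnegative.\<close>
    define eps where "eps = min (alpha\<^sup>2 / 24) (p / 2)"
    have eps: "eps > 0" "eps \<le> alpha\<^sup>2 / 24" "p - eps \<ge> 0"
      using alpha p by (auto simp: eps_def min_def)
    have "openin mtopology {z \<in> topspace mtopology. slope M d psi1 z \<in> {..<p + eps}}"
      using cont by (intro openin_continuous_map_preimage[of _ euclideanreal]) auto
    moreover have "x0 \<in> {z \<in> topspace mtopology. slope M d psi1 z \<in> {..<p + eps}}"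
      using x0 eps by (simp add: p_def)
    ultimately obtain r3 where r3: "r3 > 0" "mball x0 r3 \<subseteq> {z \<in> topspace mtopology. slope M d psi1 z \<in> {..<p + eps}}"
      by (meson openin_mtopology)
    \<comment> \<open>Half of \<open>r3\<close> is taken because
      \<open>Lipschitz_of_slope_less\<close> works on half the radius. Both \<open>y0\<close> and
      the ball of radius \<open>rho\<close> will lie within \<open>r\<close> of
      \<open>x0\<close>.\<close>
    define r where "r = Min {r1, r2, r3 / 2, delta}"
    have r: "r > 0" "r \<le> r1" "r \<le> r2" "r \<le> r3 / 2" "r \<le> delta"
      using r1 r2 r3 delta by (auto simp: r_def)
    have "p - eps < slope_minus M d psi1 x0" using minus eps by simp
    from slope_minus_gtD[OF x0 eps(3) this r(1)] obtain y0 where y0: "y0 \<in> mball x0 r" "y0 \<noteq> x0"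
      "(p - eps) * d x0 y0 < psi1 x0 - psi1 y0" by blast
    define D where "D = d x0 y0"
    have D: "D > 0" "D < r" and y0M: "y0 \<in> M" using y0 x0 by (auto simp: D_def)
    \<comment> \<open>With this \<open>k\<close> the derivative of \<open>k * t\<^sup>2\<close> at
      \<open>t = D\<close> is \<open>p\<close>.\<close>
    define k where "k = p / (2 * D)"
    define rho where "rho = alpha * D"
    have rho: "rho > 0" "rho \<le> D" using alpha D by (auto simp: rho_def)
    have k0: "k \<ge> 0" and kD: "2 * k * D = p" using p D by (auto simp: k_def)
    have "U x - U x0 \<le> k * ((d x y0)\<^sup>2 - D\<^sup>2) + (a + alpha) * d x0 x + alpha * rho / 8"
      if x: "x \<in> mcball x0 rho" for x
    proof -
      have xM: "x \<in> M" and dx: "d x0 x \<le> rho" "d x0 x < r" using x rho D by auto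
      define t where "t = d x y0"
      have t: "t \<le> 2 * D"
        using triangle[OF xM x0 y0M] dx rho by (simp add: t_def D_def commute)
      \<comment> \<open>The ascent from \<open>y0\<close> to \<open>x\<close> has rate at most
        \<open>p + eps\<close>, the descent from \<open>x0\<close> to \<open>y0\<close> rate at
        least \<open>p - eps\<close>; together they compare \<open>psi1 x\<close> with
        \<open>psi1 x0\<close>.\<close>
      have "\<bar>psi1 x - psi1 y0\<bar> \<le> (p + eps) * d y0 x"
        by (rule Lipschitz_of_slope_less[OF lip1 x0, of r3]) (use r3 dx r xM x0 y0M D in \<open>auto simp: D_def\<close>)
      then have "psi1 x - psi1 x0 \<le> (p + eps) * t - (p - eps) * D"
        using y0(3) by (simp add: t_def D_def commute)
      also have "\<dots> = p * (t - D) + eps * (D + t)" by (simp add: algebra_simps)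
      also have "\<dots> = 2 * k * D * (t - D) + eps * (D + t)" by (simp only: kD)
      also have "\<dots> \<le> k * (t\<^sup>2 - D\<^sup>2) + alpha * rho / 8"
      proof -
        \<comment> \<open>Convexity: the square lies above its tangent at \<open>D\<close>.\<close>
        have "0 \<le> k * (t - D)\<^sup>2" using k0 by simp
        then have "2 * k * D * (t - D) \<le> k * (t\<^sup>2 - D\<^sup>2)"
          by (simp add: power2_eq_square algebra_simps)
        moreover have "eps * (D + t) \<le> alpha\<^sup>2 / 24 * (3 * D)"
          using eps t D by (intro mult_mono) (auto simp: t_def)
        moreover have "alpha\<^sup>2 / 24 * (3 * D) = alpha * rho / 8"
          by (simp add: rho_def power2_eq_square)
        ultimately show ?thesis by linarith
      qed
      finally have "psi1 x - psi1 x0 \<le> k * (t\<^sup>2 - D\<^sup>2) + alpha * rho / 8" .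
      moreover have "\<bar>psi2 x - psi2 x0\<bar> \<le> (a + alpha / 2) * d x0 x"
        using dx r xM x0 by (intro r2(2)) auto
      moreover have "(a + alpha / 2) * d x0 x \<le> (a + alpha) * d x0 x"
        using alpha by (intro mult_right_mono) auto
      moreover have "U x - (psi1 x + psi2 x) \<le> U x0 - (psi1 x0 + psi2 x0)"
        using dx r xM x0 by (intro r1(2)) auto
      ultimately show ?thesis by (simp add: t_def)
    qed
    moreover have "2 * k * rho \<le> p * alpha" by (simp add: rho_def flip: kD)
    ultimately show ?thesis
      using y0M k0 rho kD D r by (intro that[of y0 k rho]) (auto simp: D_def)
  qed
qed

end

section \<open>Ekeland's variational principle\<close>

context Metric_space
begin

text \<open>Starting from \<open>x0\<close>, each next point nearly maximises \<open>f\<close> over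
  \<open>S z\<close>, the points that beat \<open>z\<close> even after paying the penalty.
  Completeness provides a limit of these points, and no compactness is involved.\<close>

lemma Ekeland_max:
  fixes f :: "'a \<Rightarrow> real"
  assumes complete: mcomplete and C: "closedin mtopology C" and x0: "x0 \<in> C"
    and bdd: "bdd_above (f ` C)" and lam: "lam > 0"
    and usc: "\<And>x c. x \<in> C \<Longrightarrow> f x < c \<Longrightarrow> \<exists>r>0. \<forall>y\<in>mball x r \<inter> C. f y < c"
  obtains z where "z \<in> C" "f x0 \<le> f z" "\<And>y. y \<in> C \<Longrightarrow> f y \<le> f z + lam * d z y"
proof -
  define S where "S z = {y \<in> C. f z + lam * d z y \<le> f y}" for z
  have CM: "C \<subseteq> M" using C closedin_subset by force
  have S_refl: "z \<in> S z" if "z \<in> C" for z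
    using that CM by (auto simp: S_def subset_iff)
  have S_trans: "x \<in> S z" if z: "z \<in> C" and y: "y \<in> S z" and x: "x \<in> S y" for x y z
  proof -
    have "d z x \<le> d z y + d y x"
      using CM z y x by (intro triangle) (auto simp: S_def)
    then have "lam * d z x \<le> lam * d z y + lam * d y x"
      using lam by (simp flip: distrib_left)
    then show ?thesis using x y by (auto simp: S_def)
  qed
  have "\<exists>y\<in>S z. \<forall>x\<in>S z. f x \<le> f y + inverse (Suc n)" if z: "z \<in> C" for z n
  proof -
    have bdd': "bdd_above (f ` S z)"
      using bdd by (rule bdd_above_mono) (auto simp: S_def)
    have "f ` S z \<noteq> {}" using S_refl[OF z] by blast
    moreover have "Sup (f ` S z) - inverse (Suc n) < Sup (f ` S z)" by simp
    ultimately obtain y where y: "y \<in> S z" "Sup (f ` S z) - inverse (Suc n) < f y"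
      using less_cSupE[of "Sup (f ` S z) - inverse (Suc n)" "f ` S z"] by (metis (no_types) imageE)
    have "f x \<le> f y + inverse (Suc n)" if "x \<in> S z" for x
      using cSup_upper[OF imageI[OF that, of f] bdd'] y(2) by linarith
    with y(1) show ?thesis by blast
  qed
  then have "\<forall>n z. \<exists>y. z \<in> C \<longrightarrow> y \<in> S z \<and> (\<forall>x\<in>S z. f x \<le> f y + inverse (Suc n))"
    by blast
  then obtain nxt where nxt': "\<And>n z. z \<in> C \<longrightarrow>
      nxt n z \<in> S z \<and> (\<forall>x\<in>S z. f x \<le> f (nxt n z) + inverse (Suc n))"
    by (simp only: choice_iff) blast
  then have nxt: "\<And>z n. z \<in> C \<Longrightarrow> nxt n z \<in> S z"
    "\<And>z n x. z \<in> C \<Longrightarrow> x \<in> S z \<Longrightarrow> f x \<le> f (nxt n z) + inverse (Suc n)"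
    by blast+
  define w where "w = rec_nat x0 nxt"
  have w0: "w 0 = x0" and wS: "w (Suc n) = nxt n (w n)" for n by (simp_all add: w_def)
  have wC: "w n \<in> C" for n
    by (induction n) (use x0 nxt(1) in \<open>auto simp: w0 wS S_def\<close>)
  have chain: "w (n + k) \<in> S (w n)" for n k
  proof (induction k)
    case 0 then show ?case using S_refl[OF wC] by simp
  next
    case (Suc k)
    then show ?case using S_trans[OF wC Suc nxt(1)[OF wC]] wS by simp
  qed
  have chain': "w m \<in> S (w n)" if "n \<le> m" for m n
    using chain[of n "m - n"] that by simp
  have step: "f (w n) + lam * d (w n) (w m) \<le> f (w m)" if "n \<le> m" for m n
    using chain'[OF that] by (simp add: S_def)
  \<comment> \<open>The values increase and are bounded, hence Cauchy. By \<open>step\<close> they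
    dominate \<open>lam\<close> times the distances, so the points are Cauchy as well.\<close>
  have "incseq (\<lambda>n. f (w n))"
  proof (rule monoI)
    fix n m :: nat assume "n \<le> m"
    moreover have "0 \<le> lam * d (w n) (w m)" using lam by simp
    ultimately show "f (w n) \<le> f (w m)" using step[of n m] by linarith
  qed
  moreover have "bdd_above (range (\<lambda>n. f (w n)))"
    using bdd by (rule bdd_above_mono) (use wC in auto)
  ultimately have "Cauchy (\<lambda>n. f (w n))"
    by (meson LIMSEQ_incseq_SUP convergent_Cauchy convergentI)
  have "MCauchy w"
    unfolding MCauchy_def
  proof (intro conjI allI impI)
    show "range w \<subseteq> M" using wC CM by auto
    fix e :: real assume "e > 0"
    then have "lam * e > 0" using lam by simp
    with \<open>Cauchy _\<close> obtain N where N: "\<And>m n. m \<ge> N \<Longrightarrow> n \<ge> N \<Longrightarrow> \<bar>f (w m) - f (w n)\<bar> < lam * e"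
      unfolding Cauchy_def dist_real_def by blast
    have *: "d (w n) (w m) < e" if "N \<le> n" "n \<le> m" for n m
    proof -
      have "lam * d (w n) (w m) < lam * e" using step[OF that(2)] N[of m n] that by linarith
      then show ?thesis using lam by simp
    qed
    have "d (w n) (w m) < e" if "N \<le> n" "N \<le> m" for n m
      using *[of n m] *[of m n] that commute by (metis nle_le)
    then show "\<exists>N. \<forall>n n'. N \<le> n \<longrightarrow> N \<le> n' \<longrightarrow> d (w n) (w n') < e" by blast
  qed
  then obtain z where z: "limitin mtopology w z sequentially"
    using complete by (auto simp: mcomplete_def)
  have zC: "z \<in> C"
    using limitin_closedin[OF z C] wC by simp
  have zM: "z \<in> M" using zC CM by blast
  \<comment> \<open>The inequality defining \<open>S (w n)\<close> survives the limit because upper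
    semicontinuity prevents \<open>f z\<close> from lying below the limiting values.\<close>
  have zS: "z \<in> S (w n)" for n
  proof -
    have "f (w n) + lam * d (w n) z \<le> f z + e" if e: "e > 0" for e
    proof -
      obtain r where r: "r > 0" "\<forall>y\<in>mball z r \<inter> C. f y < f z + e / 2"
        using usc[OF zC, of "f z + e / 2"] e by auto
      have "min r (e / (2 * lam)) > 0" using r e lam by simp
      with z obtain N where N: "\<And>m. m \<ge> N \<Longrightarrow> w m \<in> M \<and> d (w m) z < min r (e / (2 * lam))"
        unfolding limit_metric_sequentially by meson
      define m where "m = max N n"
      have m: "d (w m) z < r" "d (w m) z < e / (2 * lam)" "w m \<in> M" using N[of m] by (auto simp: m_def)
      have "f (w m) < f z + e / 2" using r(2) m(1,3) wC[of m] zM commute by auto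
      moreover have "lam * d (w m) z \<le> e / 2"
        using m(2) lam by (simp add: pos_less_divide_eq algebra_simps)
      moreover have "lam * d (w n) z \<le> lam * d (w n) (w m) + lam * d (w m) z"
        using triangle[of "w n" "w m" z] wC CM zM lam by (auto simp flip: distrib_left)
      ultimately show ?thesis using step[of n m] by (simp add: m_def)
    qed
    then have "f (w n) + lam * d (w n) z \<le> f z" by (rule field_le_epsilon)
    then show ?thesis using zC by (simp add: S_def)
  qed
  have "f y \<le> f z + lam * d z y" if y: "y \<in> C" for y
  proof (rule ccontr)
    assume neg: "\<not> ?thesis"
    \<comment> \<open>A point beating \<open>z\<close> lies in every \<open>S (w n)\<close>, where
      \<open>w (Suc n)\<close> is maximal up to \<open>1 / (n + 1)\<close>; this forces
      \<open>f y \<le> f z\<close>.\<close>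
    then have "y \<in> S z" using y by (simp add: S_def)
    then have yS: "y \<in> S (w n)" for n using S_trans[OF wC zS] by blast
    have eps: "f y \<le> f z + inverse (real (Suc n))" for n
    proof -
      have "f y \<le> f (w (Suc n)) + inverse (Suc n)" using nxt(2)[OF wC yS] wS by simp
      moreover have "0 \<le> lam * d (w (Suc n)) z" using lam by simp
      moreover have "f (w (Suc n)) + lam * d (w (Suc n)) z \<le> f z" using zS[of "Suc n"] by (simp add: S_def)
      ultimately show ?thesis by linarith
    qed
    have "f y \<le> f z"
    proof (rule field_le_epsilon)
      fix e :: real assume "e > 0"
      then obtain n where "inverse (real (Suc n)) < e" using reals_Archimedean by blast
      with eps[of n] show "f y \<le> f z + e" by linarith
    qed
    moreover have "0 \<le> lam * d z y" using lam by simp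
    ultimately show False using neg by linarith
  qed
  moreover have "f x0 \<le> f z"
  proof -
    have "0 \<le> lam * d (w 0) z" using lam by simp
    with zS[of 0] w0 show ?thesis by (simp add: S_def)
  qed
  ultimately show ?thesis using that zC by blast
qed

end

section \<open>Stability of subsolutions\<close>

text \<open>The convergence hypotheses concern sequences indexed by all \<open>n\<close>, while
  compactness yields points only along a subsequence \<open>r\<close>. The gaps are filled by
  \<open>w\<close>.\<close>

lemma tendsto_fill_subseq:
  fixes r :: "nat \<Rightarrow> nat"
  assumes r: "strict_mono r" and y: "y \<longlonglongrightarrow> l" and w: "w \<longlonglongrightarrow> l"
  shows "(\<lambda>n. if n \<in> range r then y (inv r n) else w n) \<longlonglongrightarrow> l"
proof (rule topological_tendstoI)
  fix S assume S: "open S" "l \<in> S"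
  obtain K where K: "\<And>k. k \<ge> K \<Longrightarrow> y k \<in> S"
    using topological_tendstoD[OF y S] by (auto simp: eventually_sequentially)
  obtain L where L: "\<And>k. k \<ge> L \<Longrightarrow> w k \<in> S"
    using topological_tendstoD[OF w S] by (auto simp: eventually_sequentially)
  have inv: "inv r (r k) = k" for k
    using r by (simp add: strict_mono_imp_inj_on)
  have "(if n \<in> range r then y (inv r n) else w n) \<in> S" if n: "n \<ge> max (r K) L" for n
  proof (cases "n \<in> range r")
    case True
    then obtain k where k: "n = r k" by blast
    then have "k \<ge> K" using n r by (simp add: strict_mono_less_eq)
    with K k inv show ?thesis by simp
  next
    case False
    then show ?thesis using L n by simp
  qed
  then show "\<forall>\<^sub>F n in sequentially. (if n \<in> range r then y (inv r n) else w n) \<in> S"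
    unfolding eventually_sequentially by blast
qed

text \<open>This isolates what the limit argument uses of the convergence of spaces.
  \<open>convergent_subseq\<close> expresses joint compactness in the ambient distance; together
  with \<open>dist_le\<close> it replaces compactness of the single spaces for
  \<open>D n\<close>.\<close>

locale converging_spaces =
  fixes X :: "enat \<Rightarrow> 'a::metric_space set" and D :: "enat \<Rightarrow> 'a \<Rightarrow> 'a \<Rightarrow> real"
  assumes spaces: "\<And>n. geodesic_metric_space (X n) (D n)"
    and dist_le: "\<And>n x y. x \<in> X n \<Longrightarrow> y \<in> X n \<Longrightarrow> dist x y \<le> D n x y"
    and approx_seqs_ex: "\<And>x. x \<in> X \<infinity> \<Longrightarrow> \<exists>s. s \<in> approx_seqs X x"
    and convergent_subseq: "\<And>(r :: nat \<Rightarrow> nat) (z :: nat \<Rightarrow> 'a). strict_mono r \<Longrightarrow> (\<And>k. z k \<in> X (enat (r k))) \<Longrightarrow>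
        \<exists>l\<in>X \<infinity>. \<exists>q. strict_mono q \<and> (z \<circ> q) \<longlonglongrightarrow> l"
    and D_conv: "\<And>a b as bs. \<lbrakk>a \<in> X \<infinity>; b \<in> X \<infinity>; as \<in> approx_seqs X a; bs \<in> approx_seqs X b\<rbrakk>
          \<Longrightarrow> (\<lambda>n. D (enat n) (as n) (bs n)) \<longlonglongrightarrow> D \<infinity> a b"
begin

lemma approx_seqs_fill:
  assumes "l \<in> X \<infinity>" "strict_mono r" "\<And>k. z k \<in> X (enat (r k))" "z \<longlonglongrightarrow> l"
  obtains s where "s \<in> approx_seqs X l" "\<And>k. s (r k) = z k"
proof -
  obtain w where w: "w \<in> approx_seqs X l" using approx_seqs_ex[OF assms(1)] by blast
  let ?s = "\<lambda>n. if n \<in> range r then z (inv r n) else w n"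
  have inv: "inv r (r k) = k" for k
    using assms(2) by (simp add: strict_mono_imp_inj_on)
  have "?s \<longlonglongrightarrow> l"
    using tendsto_fill_subseq[OF assms(2,4)] w by (auto simp: approx_seqs_def)
  moreover have "?s n \<in> X (enat n)" for n
    using assms(3) w inv by (auto simp: approx_seqs_def)
  ultimately have "?s \<in> approx_seqs X l" by (simp add: approx_seqs_def)
  then show ?thesis using that[of ?s] inv by simp
qed

text \<open>Compactness makes the statement uniform: points violating \<open>P\<close> at infinitely
  many indices would accumulate at some \<open>l\<close> in the limit space and could be completed
  to an approximating sequence of \<open>l\<close>.\<close>

lemma eventually_all_of_approx_seqs:
  assumes "\<And>l s. l \<in> X \<infinity> \<Longrightarrow> s \<in> approx_seqs X l \<Longrightarrow> \<forall>\<^sub>F n in sequentially. P n (s n)"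
  shows "\<forall>\<^sub>F n in sequentially. \<forall>z\<in>X (enat n). P n z"
proof (rule ccontr)
  assume neg: "\<not> ?thesis"
  have "infinite {n. \<exists>z\<in>X (enat n). \<not> P n z}"
    using neg by (auto simp: eventually_sequentially infinite_nat_iff_unbounded_le)
  then obtain r :: "nat \<Rightarrow> nat" where r: "strict_mono r" "\<And>k. r k \<in> {n. \<exists>z\<in>X (enat n). \<not> P n z}"
    using infinite_enumerate by blast
  then have "\<forall>k. \<exists>z. z \<in> X (enat (r k)) \<and> \<not> P (r k) z" by blast
  then obtain z where z: "\<And>k. z k \<in> X (enat (r k))" "\<And>k. \<not> P (r k) (z k)" by metis
  obtain l q where l: "l \<in> X \<infinity>" "strict_mono q" "(z \<circ> q) \<longlonglongrightarrow> l"
    using convergent_subseq[of r z, OF r(1)] z(1) by blast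
  obtain s where s: "s \<in> approx_seqs X l" "\<And>k. s ((r \<circ> q) k) = (z \<circ> q) k"
    using approx_seqs_fill[OF l(1) strict_mono_o[OF r(1) l(2)] _ l(3)] z(1) by (metis comp_apply)
  from assms[OF l(1) s(1)] obtain N where N: "\<And>n. n \<ge> N \<Longrightarrow> P n (s n)"
    by (auto simp: eventually_sequentially)
  have "P (r (q N)) (s (r (q N)))"
    using seq_suble[OF strict_mono_o[OF r(1) l(2)]] by (intro N) auto
  with s(2)[of N] z(2)[of "q N"] show False by simp
qed

text \<open>Passing to envelopes does not raise the semilimit: the envelope at \<open>s n\<close> is
  nearly attained by \<open>u n\<close> within \<open>D\<close>-distance \<open>1 / (n + 1)\<close>,
  and such points still converge to \<open>l\<close> because \<open>D\<close> dominates
  \<open>dist\<close>.\<close>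

lemma envelope_upper_semilimit:
  fixes u :: "nat \<Rightarrow> 'a \<Rightarrow> real"
  assumes fin_env: "\<And>n x. x \<in> X (enat n) \<Longrightarrow> \<bar>usc_envelope (X (enat n)) (D (enat n)) (u n) x\<bar> \<noteq> \<infinity>"
    and fin: "\<bar>upper_semilimit X u l\<bar> \<noteq> \<infinity>"
    and l: "l \<in> X \<infinity>" and s: "s \<in> approx_seqs X l"
    and c: "real_of_ereal (upper_semilimit X u l) < c"
  shows "\<forall>\<^sub>F n in sequentially. real_of_ereal (usc_envelope (X (enat n)) (D (enat n)) (u n) (s n)) < c"
proof -
  let ?us = "\<lambda>n. real_of_ereal (usc_envelope (X (enat n)) (D (enat n)) (u n) (s n))"
  \<comment> \<open>The gap \<open>c - c'\<close> pays for the near attainment of the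
    envelope.\<close>
  obtain c' where c': "real_of_ereal (upper_semilimit X u l) < c'" "c' < c"
    using dense c by blast
  have sX: "s n \<in> X (enat n)" for n using s by (simp add: approx_seqs_def)
  have "\<exists>y. y \<in> X (enat n) \<and> D (enat n) (s n) y < inverse (Suc n) \<and> ?us n - (c - c') < u n y" for n
  proof -
    interpret geodesic_metric_space "X (enat n)" "D (enat n)" by (rule spaces)
    have "ereal (?us n - (c - c')) < usc_envelope (X (enat n)) (D (enat n)) (u n) (s n)"
      using fin_env[OF sX, of n] c'(2)
      by (cases "usc_envelope (X (enat n)) (D (enat n)) (u n) (s n)") auto
    from usc_envelope_gtD[OF sX this, of "inverse (Suc n)"] show ?thesis by auto
  qed
  then obtain y where y: "\<And>n. y n \<in> X (enat n)" "\<And>n. D (enat n) (s n) (y n) < inverse (Suc n)"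
    "\<And>n. ?us n - (c - c') < u n (y n)" by metis
  have "(\<lambda>n. dist (s n) (y n)) \<longlonglongrightarrow> 0"
  proof (rule tendsto_sandwich[OF _ _ tendsto_const LIMSEQ_inverse_real_of_nat])
    show "\<forall>\<^sub>F n in sequentially. dist (s n) (y n) \<le> inverse (real (Suc n))"
      using dist_le[OF sX y(1)] y(2) by (intro always_eventually allI) (meson less_imp_le order_trans)
  qed auto
  moreover have "s \<longlonglongrightarrow> l" using s by (simp add: approx_seqs_def)
  ultimately have lim: "(\<lambda>n. dist (s n) (y n) + dist (s n) l) \<longlonglongrightarrow> 0"
    unfolding tendsto_dist_iff[of s] by (rule tendsto_add_zero)
  have "y \<longlonglongrightarrow> l"
    unfolding tendsto_dist_iff[of y]
    by (rule tendsto_sandwich[OF _ _ tendsto_const lim]) (auto simp: dist_triangle3)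
  then have "y \<in> approx_seqs X l" using y(1) by (simp add: approx_seqs_def)
  then have "limsup (\<lambda>n. ereal (u n (y n))) \<le> upper_semilimit X u l"
    unfolding upper_semilimit_def by (rule SUP_upper)
  also have "\<dots> < ereal c'" using c' fin by (cases "upper_semilimit X u l") auto
  finally have "\<forall>\<^sub>F n in sequentially. ereal (u n (y n)) < ereal c'"
    by (rule Limsup_lessD)
  then show ?thesis
  proof eventually_elim
    case (elim n)
    with y(3)[of n] show ?case by simp
  qed
qed

text \<open>The viscosity inequality is found at points \<open>z\<close> near \<open>x0\<close> with
  nearly the right value and momentum. It holds for some \<open>n\<close> beyond each
  \<open>N\<close>, not for all large \<open>n\<close>, since values near \<open>U x0\<close> are
  guaranteed only along a subsequence. The bound for \<open>H\<close> is \<open>delta\<close>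
  because the infimum in \<open>H_lower\<close> need not be attained.\<close>

lemma subsolution_near:
  fixes u :: "nat \<Rightarrow> 'a \<Rightarrow> real" and H :: "enat \<Rightarrow> 'a \<Rightarrow> real \<Rightarrow> real \<Rightarrow> real"
  defines "U \<equiv> \<lambda>x. real_of_ereal (upper_semilimit X u x)"
    and "us \<equiv> \<lambda>n x. real_of_ereal (usc_envelope (X (enat n)) (D (enat n)) (u n) x)"
  assumes sub: "\<And>n. metric_viscosity_subsolution (X (enat n)) (D (enat n)) (H (enat n)) (u n)"
    and fin: "\<And>x. x \<in> X \<infinity> \<Longrightarrow> \<bar>upper_semilimit X u x\<bar> \<noteq> \<infinity>"
    and usc: "upper_semicontinuous (X \<infinity>) (D \<infinity>) U"
    and psi1: "C1_minus (X \<infinity>) (D \<infinity>) psi1" and psi2: "locally_Lipschitz (X \<infinity>) (D \<infinity>) psi2"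
    and max: "local_max_at (X \<infinity>) (D \<infinity>) (\<lambda>y. U y - (psi1 y + psi2 y)) x0"
    and delta: "0 < delta"
  defines "p \<equiv> slope (X \<infinity>) (D \<infinity>) psi1 x0"
    and "a \<equiv> real_of_ereal (usc_envelope (X \<infinity>) (D \<infinity>) (slope (X \<infinity>) (D \<infinity>) psi2) x0)"
  shows "\<exists>n\<ge>N. \<exists>z\<in>X (enat n). \<exists>p'\<ge>0. dist z x0 < delta \<and> \<bar>us n z - U x0\<bar> < delta \<and>
      \<bar>p' - p\<bar> \<le> a + delta \<and> H (enat n) z (us n z) p' \<le> delta"
proof -
  interpret L: geodesic_metric_space "X \<infinity>" "D \<infinity>" by (rule spaces)
  have x0: "x0 \<in> X \<infinity>" using max by (simp add: local_max_at_def)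
  have p0: "0 \<le> p" by (simp add: p_def L.slope_nonneg)
  have a0: "0 \<le> a"
    using L.slope_usc_envelope[OF psi2 x0] L.slope_nonneg order_trans unfolding a_def by blast
  \<comment> \<open>The final momentum error is \<open>3 * alpha\<close> from the Lipschitz part and
    \<open>p * alpha\<close> from the variation of the quadratic's slope.\<close>
  define alpha where "alpha = min 1 (delta / (3 + p))"
  have alpha: "0 < alpha" "alpha \<le> 1" using delta p0 by (auto simp: alpha_def)
  have "alpha \<le> delta / (3 + p)" by (simp add: alpha_def)
  then have alpha_delta: "3 * alpha + p * alpha \<le> delta"
    using p0 by (simp add: pos_le_divide_eq algebra_simps)
  have "openin L.mtopology {x \<in> X \<infinity>. U x < U x0 + delta}"
    using usc by (simp add: upper_semicontinuous_def)
  moreover have "x0 \<in> {x \<in> X \<infinity>. U x < U x0 + delta}" using x0 delta by simp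
  ultimately obtain ru where ru: "ru > 0" "L.mball x0 ru \<subseteq> {x \<in> X \<infinity>. U x < U x0 + delta}"
    by (meson L.openin_mtopology)
  \<comment> \<open>The first bound yields \<open>(1 + p) * rho \<le> delta\<close>, used for the
    value of \<open>us n z\<close>; the second keeps the ball of radius \<open>rho\<close> where
    \<open>U < U x0 + delta\<close>.\<close>
  define delta0 where "delta0 = min (delta / (1 + p)) (ru / 2)"
  have delta0: "delta0 > 0" using delta p0 ru by (auto simp: delta0_def)
  obtain y0 k rho where y0: "y0 \<in> X \<infinity>" and k: "0 \<le> k" and rho: "0 < rho" "rho \<le> delta0"
    and kD: "2 * k * D \<infinity> x0 y0 = p" and krho: "2 * k * rho \<le> p * alpha"
    and touch: "\<And>x. x \<in> L.mcball x0 rho \<Longrightarrow>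
       U x - U x0 \<le> k * ((D \<infinity> x y0)\<^sup>2 - (D \<infinity> x0 y0)\<^sup>2) + (a + alpha) * D \<infinity> x0 x + alpha * rho / 8"
    using L.touching_quadratic[OF psi1 psi2 max alpha delta0] unfolding p_def a_def by metis
  have "rho \<le> delta / (1 + p)" using rho by (simp add: delta0_def)
  then have rho_delta: "rho + p * rho \<le> delta"
    using p0 by (simp add: pos_le_divide_eq algebra_simps)
  have p_rho: "0 \<le> p * rho" using p0 rho by simp
  have rho_ru: "rho < ru" using rho ru by (simp add: delta0_def)
  define D0 where "D0 = D \<infinity> x0 y0"
  have "ereal (U x0 - alpha * rho / 16) < upper_semilimit X u x0"
    using fin[OF x0] alpha rho by (cases "upper_semilimit X u x0") (auto simp: U_def)
  then obtain xs where xs: "xs \<in> approx_seqs X x0"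
    and xs_gt: "ereal (U x0 - alpha * rho / 16) < limsup (\<lambda>n. ereal (u n (xs n)))"
    unfolding upper_semilimit_def less_SUP_iff by blast
  obtain ys where ys: "ys \<in> approx_seqs X y0" using approx_seqs_ex[OF y0] by blast
  have xsX: "xs n \<in> X (enat n)" and ysX: "ys n \<in> X (enat n)" for n
    using xs ys by (auto simp: approx_seqs_def)
  have fin_env: "\<bar>usc_envelope (X (enat n)) (D (enat n)) (u n) x\<bar> \<noteq> \<infinity>" if "x \<in> X (enat n)" for n x
    using sub[of n] that by (simp add: metric_viscosity_subsolution_def)
  \<comment> \<open>The coefficient \<open>2 * alpha\<close> exceeds the \<open>alpha\<close> of
    \<open>touch\<close>; the surplus will confine near maximisers to the vicinity of
    \<open>xs n\<close>.\<close>
  define F where "F n z = us n z - k * (D (enat n) z (ys n))\<^sup>2 - (a + 2 * alpha) * D (enat n) z (xs n)" for n z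
  define F0 where "F0 = U x0 - k * D0\<^sup>2"
  \<comment> \<open>The radius stays below \<open>rho\<close>: if the limit point is farther than
    \<open>rho\<close> from \<open>x0\<close>, the premise eventually fails, and otherwise
    \<open>touch\<close> applies.\<close>
  define P where "P n z \<longleftrightarrow> (D (enat n) z (xs n) \<le> 3 / 4 * rho \<longrightarrow>
      F n z + alpha * D (enat n) z (xs n) < F0 + alpha * rho / 4 \<and> us n z < U x0 + delta)" for n z
  have "\<forall>\<^sub>F n in sequentially. \<forall>z\<in>X (enat n). P n z"
  proof (rule eventually_all_of_approx_seqs)
    fix l s assume l: "l \<in> X \<infinity>" and s: "s \<in> approx_seqs X l"
    have limx: "(\<lambda>n. D (enat n) (s n) (xs n)) \<longlonglongrightarrow> D \<infinity> l x0"
      by (rule D_conv[OF l x0 s xs])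
    have limy: "(\<lambda>n. D (enat n) (s n) (ys n)) \<longlonglongrightarrow> D \<infinity> l y0"
      by (rule D_conv[OF l y0 s ys])
    show "\<forall>\<^sub>F n in sequentially. P n (s n)"
    proof (cases "D \<infinity> l x0 \<le> rho")
      case False
      then have "3 / 4 * rho < D \<infinity> l x0" using rho by simp
      from order_tendstoD(1)[OF limx this] show ?thesis
        by eventually_elim (simp add: P_def)
    next
      case True
      define G where "G n = k * (D (enat n) (s n) (ys n))\<^sup>2 + (a + alpha) * D (enat n) (s n) (xs n)" for n
      define G0 where "G0 = k * (D \<infinity> l y0)\<^sup>2 + (a + alpha) * D \<infinity> l x0"
      have "G \<longlonglongrightarrow> G0"
        unfolding G_def G0_def by (intro tendsto_intros limx limy)
      moreover have "G0 - alpha * rho / 16 < G0" using alpha rho by simp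
      ultimately have evG: "\<forall>\<^sub>F n in sequentially. G0 - alpha * rho / 16 < G n"
        by (rule order_tendstoD(1))
      have "U l < U l + alpha * rho / 16" using alpha rho by simp
      then have ev1: "\<forall>\<^sub>F n in sequentially. us n (s n) < U l + alpha * rho / 16"
        unfolding U_def us_def by (rule envelope_upper_semilimit[OF _ fin[OF l] l s, rotated]) (rule fin_env)
      have "U l < U x0 + delta"
        using subsetD[OF ru(2), of l] True l x0 rho_ru L.commute[of l x0] by simp
      then have ev2: "\<forall>\<^sub>F n in sequentially. us n (s n) < U x0 + delta"
        unfolding U_def us_def by (rule envelope_upper_semilimit[OF _ fin[OF l] l s, rotated]) (rule fin_env)
      have bound: "U l - U x0 \<le> k * ((D \<infinity> l y0)\<^sup>2 - D0\<^sup>2) + (a + alpha) * D \<infinity> l x0 + alpha * rho / 8"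
        using touch[of l] True l x0 L.commute[of l x0] by (simp add: D0_def)
      \<comment> \<open>The error adds up as \<open>1/8 + 1/16 + 1/16 = 1/4\<close> in units of
        \<open>alpha * rho\<close>.\<close>
      from evG ev1 ev2 show ?thesis
      proof eventually_elim
        case (elim n)
        have "F n (s n) + alpha * D (enat n) (s n) (xs n) = us n (s n) - G n"
          by (simp add: F_def G_def algebra_simps)
        moreover have "U l \<le> F0 + G0 + alpha * rho / 8"
          using bound by (simp add: F0_def G0_def algebra_simps)
        ultimately show ?case using elim by (simp add: P_def)
      qed
    qed
  qed
  moreover have "\<forall>\<^sub>F n in sequentially. \<bar>D (enat n) (xs n) (ys n) - D0\<bar> < rho / 4"
    using tendstoD[OF D_conv[OF x0 y0 xs ys], of "rho / 4"] rho by (simp add: dist_real_def D0_def)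
  moreover have "\<forall>\<^sub>F n in sequentially. k * (D (enat n) (xs n) (ys n))\<^sup>2 < k * D0\<^sup>2 + alpha * rho / 16"
  proof (rule order_tendstoD(2))
    show "(\<lambda>n. k * (D (enat n) (xs n) (ys n))\<^sup>2) \<longlonglongrightarrow> k * D0\<^sup>2"
      unfolding D0_def by (intro tendsto_intros D_conv[OF x0 y0 xs ys])
  qed (use alpha rho in simp)
  moreover have "\<forall>\<^sub>F n in sequentially. dist (xs n) x0 < delta / 4"
    using xs delta by (intro tendstoD) (auto simp: approx_seqs_def)
  moreover have "\<forall>\<^sub>F n in sequentially. n \<ge> N" by (rule eventually_ge_at_top)
  ultimately have ev: "\<forall>\<^sub>F n in sequentially. (\<forall>z\<in>X (enat n). P n z) \<and>
      \<bar>D (enat n) (xs n) (ys n) - D0\<bar> < rho / 4 \<and>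
      k * (D (enat n) (xs n) (ys n))\<^sup>2 < k * D0\<^sup>2 + alpha * rho / 16 \<and>
      dist (xs n) x0 < delta / 4 \<and> n \<ge> N"
    by eventually_elim blast
  \<comment> \<open>The first condition holds for infinitely many \<open>n\<close> by the upper
    limit, the others for all large \<open>n\<close>.\<close>
  have "\<exists>n. U x0 - alpha * rho / 16 < u n (xs n) \<and> (\<forall>z\<in>X (enat n). P n z) \<and>
      \<bar>D (enat n) (xs n) (ys n) - D0\<bar> < rho / 4 \<and>
      k * (D (enat n) (xs n) (ys n))\<^sup>2 < k * D0\<^sup>2 + alpha * rho / 16 \<and>
      dist (xs n) x0 < delta / 4 \<and> n \<ge> N"
  proof (rule ccontr)
    assume neg: "\<not> ?thesis"
    from ev have "\<forall>\<^sub>F n in sequentially. ereal (u n (xs n)) \<le> ereal (U x0 - alpha * rho / 16)"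
    proof eventually_elim
      case (elim n)
      with neg have "\<not> U x0 - alpha * rho / 16 < u n (xs n)" by blast
      then show ?case by simp
    qed
    then have "limsup (\<lambda>n. ereal (u n (xs n))) \<le> ereal (U x0 - alpha * rho / 16)"
      by (rule Limsup_bounded)
    with xs_gt show False by simp
  qed
  then obtain n where n: "U x0 - alpha * rho / 16 < u n (xs n)"
    "\<And>z. z \<in> X (enat n) \<Longrightarrow> P n z" "\<bar>D (enat n) (xs n) (ys n) - D0\<bar> < rho / 4"
    "k * (D (enat n) (xs n) (ys n))\<^sup>2 < k * D0\<^sup>2 + alpha * rho / 16"
    "dist (xs n) x0 < delta / 4" "n \<ge> N" by blast
  define M where "M = X (enat n)"
  define d where "d = D (enat n)"
  interpret geodesic_metric_space M d unfolding M_def d_def by (rule spaces)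
  define xn where "xn = xs n"
  define yn where "yn = ys n"
  have xnM: "xn \<in> M" and ynM: "yn \<in> M" using xsX ysX by (auto simp: xn_def yn_def M_def)
  have F_eq: "F n z = us n z - k * (d z yn)\<^sup>2 - (a + 2 * alpha) * d z xn" for z
    by (simp add: F_def d_def xn_def yn_def)
  have P: "F n z + alpha * d z xn < F0 + alpha * rho / 4" "us n z < U x0 + delta"
    if "z \<in> M" "d z xn \<le> 3 / 4 * rho" for z
    using n(2)[of z] that by (auto simp: P_def M_def d_def xn_def)
  have Fxn: "F0 - alpha * rho / 8 < F n xn"
  proof -
    have "u n xn \<le> us n xn"
      using le_usc_envelope[OF xnM, of "u n"] fin_env[of xn n] xnM
      unfolding us_def M_def d_def
      by (cases "usc_envelope (X (enat n)) (D (enat n)) (u n) xn") auto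
    then show ?thesis using n(1,4) xnM by (simp add: F_eq F0_def xn_def yn_def d_def[symmetric])
  qed
  define C where "C = mcball xn (3 / 4 * rho)"
  have C: "z \<in> C \<longleftrightarrow> z \<in> M \<and> d z xn \<le> 3 / 4 * rho" for z
    using xnM by (auto simp: C_def commute)
  have usc_us: "\<exists>r>0. \<forall>y\<in>mball x r. us n y < c" if "x \<in> M" "us n x < c" for x c
    using usc_envelope_usc[of "u n" x c] fin_env[of _ n] that by (simp add: us_def M_def d_def)
  have uscF: "\<exists>r>0. \<forall>y\<in>mball x r \<inter> C. F n y < c" if x: "x \<in> C" and c: "F n x < c" for x c
  proof -
    have xM: "x \<in> M" using x C by simp
    define e where "e = (c - F n x) / 4"
    have e: "e > 0" using c by (simp add: e_def)
    obtain r1 where r1: "r1 > 0" "\<forall>y\<in>mball x r1. us n y < us n x + e"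
      using usc_us[OF xM, of "us n x + e"] e by auto
    obtain r2 where r2: "r2 > 0" "\<forall>y\<in>mball x r2. \<bar>k * (d y yn)\<^sup>2 - k * (d x yn)\<^sup>2\<bar> < e"
      using locally_Lipschitz_close[OF _ xM e] C1_minus_sq_dist[OF ynM k] unfolding C1_minus_def by blast
    \<comment> \<open>The zero summand fits a single distance into the lemma on two.\<close>
    obtain r3 where r3: "r3 > 0"
      "\<forall>y\<in>mball x r3. \<bar>((a + 2 * alpha) * d y xn + 0 * d y xn) - ((a + 2 * alpha) * d x xn + 0 * d x xn)\<bar> < e"
      using locally_Lipschitz_close[OF dist_combination_locally_Lipschitz[OF xnM xnM, of "a + 2 * alpha" 0] xM e]
        a0 alpha by auto
    have "F n y < c" if y: "y \<in> mball x (min r1 (min r2 r3))" for y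
    proof -
      have "us n y < us n x + e" "\<bar>k * (d y yn)\<^sup>2 - k * (d x yn)\<^sup>2\<bar> < e"
        "\<bar>(a + 2 * alpha) * d y xn - (a + 2 * alpha) * d x xn\<bar> < e"
        using y r1(2) r2(2) r3(2) by auto
      then have "F n y < F n x + 3 * e" unfolding F_eq by linarith
      then show ?thesis using e unfolding e_def by argo
    qed
    moreover have "min r1 (min r2 r3) > 0" using r1 r2 r3 by simp
    ultimately show ?thesis by blast
  qed
  have bdd: "bdd_above (F n ` C)"
  proof (rule bdd_aboveI2)
    fix z assume "z \<in> C"
    then have "F n z + alpha * d z xn < F0 + alpha * rho / 4" using P C by blast
    moreover have "0 \<le> alpha * d z xn" using alpha by simp
    ultimately show "F n z \<le> F0 + alpha * rho / 4" by linarith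
  qed
  have closed: "closedin mtopology C" by (simp add: C_def)
  have xnC: "xn \<in> C" using C xnM rho by simp
  \<comment> \<open>Ekeland's principle on the closed ball \<open>C\<close>: \<open>z\<close>
    maximises \<open>F n\<close> minus \<open>alpha\<close> times the distance to
    \<open>z\<close>.\<close>
  obtain z where z: "z \<in> C" "F n xn \<le> F n z" "\<And>y. y \<in> C \<Longrightarrow> F n y \<le> F n z + alpha * d z y"
    using Ekeland_max[OF mcomplete closed xnC bdd alpha(1) uscF] by blast
  have zM: "z \<in> M" and zC: "d z xn \<le> 3 / 4 * rho" using z(1) C by auto
  \<comment> \<open>The upper bound \<open>F0 + alpha * rho / 4\<close> and the lower bound
    \<open>F0 - alpha * rho / 8\<close> leave less than \<open>3/8 * alpha * rho\<close> for the
    surplus penalty. This is half the radius of \<open>C\<close>, so \<open>z\<close> is interior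
    and the maximum is a local one in the whole space.\<close>
  have dz: "d z xn < 3 / 8 * rho"
  proof -
    have "alpha * d z xn < alpha * (3 / 8 * rho)"
      using P(1)[OF zM zC] Fxn z(2) by (simp add: algebra_simps)
    then show ?thesis using alpha by simp
  qed
  let ?psi1 = "\<lambda>y. k * (d y yn)\<^sup>2"
  let ?psi2 = "\<lambda>y. (a + 2 * alpha) * d y xn + alpha * d y z"
  have lmax: "local_max_at M d (\<lambda>y. us n y - (?psi1 y + ?psi2 y)) z"
    unfolding local_max_at_def
  proof (intro conjI exI[of _ "3 / 8 * rho"] ballI)
    show "z \<in> M" by (rule zM)
    show "0 < 3 / 8 * rho" using rho by simp
    fix y assume y: "y \<in> mball z (3 / 8 * rho)"
    then have "y \<in> C" using C triangle[of y z xn] zM xnM dz commute[of y z] by simp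
    from z(3)[OF this] show "us n y - (?psi1 y + ?psi2 y) \<le> us n z - (?psi1 z + ?psi2 z)"
      using zM by (simp add: F_eq commute[of y z])
  qed
  define b where "b = real_of_ereal (usc_envelope M d (slope M d ?psi2) z)"
  have b: "b \<le> a + 3 * alpha"
    using dist_combination_slope_le[OF xnM zM, of "a + 2 * alpha" alpha z] zM a0 alpha
    by (simp add: b_def)
  have "H_lower (H (enat n)) b z (us n z) (slope M d ?psi1 z) \<le> 0"
    using sub[of n, folded M_def d_def, unfolded metric_viscosity_subsolution_def] lmax
      C1_minus_sq_dist[OF ynM k]
      dist_combination_locally_Lipschitz[OF xnM zM, of "a + 2 * alpha" alpha] a0 alpha
    unfolding b_def us_def M_def[symmetric] d_def[symmetric] by simp
  then have "H_lower (H (enat n)) b z (us n z) (2 * k * d z yn) < ereal delta"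
    using sq_dist_slopes(1)[OF ynM k zM] delta by (simp add: order.strict_trans1)
  then obtain p' where p': "p' \<ge> 0" "\<bar>p' - 2 * k * d z yn\<bar> \<le> b" "H (enat n) z (us n z) p' < delta"
    unfolding H_lower_def INF_less_iff by auto
  have dzy: "\<bar>d z yn - D0\<bar> \<le> rho"
  proof -
    have "\<bar>d z yn - d xn yn\<bar> \<le> d z xn"
      using mdist_reverse_triangle[OF zM ynM xnM] by (simp add: commute)
    then show ?thesis using n(3) zC rho(1) unfolding xn_def yn_def d_def by linarith
  qed
  have kdz: "\<bar>2 * k * (d z yn - D0)\<bar> \<le> 2 * k * rho"
    using dzy k by (simp add: abs_mult mult_left_mono)
  have "\<bar>p' - p\<bar> \<le> a + delta"
  proof -
    have "2 * k * d z yn - p = 2 * k * (d z yn - D0)"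
      using kD by (simp add: D0_def algebra_simps)
    then show ?thesis using kdz p'(2) b krho alpha_delta by linarith
  qed
  moreover have "dist z x0 < delta"
  proof -
    have "dist z xn \<le> d z xn"
      using dist_le zM xnM by (simp add: M_def d_def)
    moreover have "dist z x0 \<le> dist z xn + dist xn x0" by (rule dist_triangle)
    ultimately show ?thesis
      using dz n(5) rho_delta p_rho rho unfolding xn_def by linarith
  qed
  moreover have "\<bar>us n z - U x0\<bar> < delta"
  proof -
    have "us n z < U x0 + delta" using P(2)[OF zM zC] .
    \<comment> \<open>Since \<open>F n z\<close> is at least \<open>F n xn\<close>, only the
      quadratic could lower the value. By its tangent at \<open>D0\<close> it costs at most
      \<open>p * rho\<close>.\<close>
    moreover have "U x0 - delta < us n z"
    proof -
      have "0 \<le> (a + 2 * alpha) * d z xn" using a0 alpha by simp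
      then have 1: "U x0 - alpha * rho / 8 + (k * (d z yn)\<^sup>2 - k * D0\<^sup>2) < us n z"
        using Fxn z(2) unfolding F_eq[of z] F0_def by linarith
      have "0 \<le> k * (d z yn - D0)\<^sup>2" using k by simp
      then have "2 * k * D0 * (d z yn - D0) \<le> k * (d z yn)\<^sup>2 - k * D0\<^sup>2"
        by (simp add: power2_eq_square algebra_simps)
      then have 2: "p * (d z yn - D0) \<le> k * (d z yn)\<^sup>2 - k * D0\<^sup>2"
        using kD by (simp add: D0_def)
      have "p * (- rho) \<le> p * (d z yn - D0)"
        using dzy p0 by (intro mult_left_mono) auto
      then have "- (p * rho) \<le> k * (d z yn)\<^sup>2 - k * D0\<^sup>2" using 2 by simp
      moreover have "alpha * rho \<le> rho" using alpha rho by simp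
      ultimately show ?thesis using 1 rho_delta rho by linarith
    qed
    ultimately show ?thesis by linarith
  qed
  ultimately show ?thesis
    using n(6) zM p' unfolding M_def by (meson less_imp_le)
qed

text \<open>\<open>subsolution_near\<close> is applied with \<open>delta = 1 / (j + 1)\<close> along
  increasing indices. The momenta are bounded, so a subsequence converges to some \<open>pl\<close>,
  and \<open>pl\<close> is a competitor in the infimum \<open>H_lower\<close> that gives a value
  \<open>\<le> 0\<close>.\<close>

lemma subsolution_stability:
  fixes u :: "nat \<Rightarrow> 'a \<Rightarrow> real" and H :: "enat \<Rightarrow> 'a \<Rightarrow> real \<Rightarrow> real \<Rightarrow> real"
  assumes H_conv: "\<And>x xs u us p ps. \<lbrakk>x \<in> X \<infinity>; xs \<in> approx_seqs X x; us \<longlonglongrightarrow> u;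
          \<And>n. ps n \<ge> 0; p \<ge> 0; ps \<longlonglongrightarrow> p\<rbrakk>
          \<Longrightarrow> (\<lambda>n. H (enat n) (xs n) (us n) (ps n)) \<longlonglongrightarrow> H \<infinity> x u p"
    and sub: "\<And>n. metric_viscosity_subsolution (X (enat n)) (D (enat n)) (H (enat n)) (u n)"
    and fin: "\<And>x. x \<in> X \<infinity> \<Longrightarrow> \<bar>upper_semilimit X u x\<bar> \<noteq> \<infinity>"
    and usc: "upper_semicontinuous (X \<infinity>) (D \<infinity>) (\<lambda>x. real_of_ereal (upper_semilimit X u x))"
  shows "metric_viscosity_subsolution (X \<infinity>) (D \<infinity>) (H \<infinity>)
            (\<lambda>x. real_of_ereal (upper_semilimit X u x))"
proof -
  interpret L: geodesic_metric_space "X \<infinity>" "D \<infinity>" by (rule spaces)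
  define U where "U = (\<lambda>x. real_of_ereal (upper_semilimit X u x))"
  have env: "usc_envelope (X \<infinity>) (D \<infinity>) U x = ereal (U x)" if "x \<in> X \<infinity>" for x
    using L.usc_envelope_upper_semicontinuous[OF usc that] by (simp add: U_def)
  have "H_lower (H \<infinity>) (real_of_ereal (usc_envelope (X \<infinity>) (D \<infinity>) (slope (X \<infinity>) (D \<infinity>) psi2) x0)) x0
      (real_of_ereal (usc_envelope (X \<infinity>) (D \<infinity>) U x0)) (slope (X \<infinity>) (D \<infinity>) psi1 x0) \<le> 0"
    if psi1: "C1_minus (X \<infinity>) (D \<infinity>) psi1" and psi2: "locally_Lipschitz (X \<infinity>) (D \<infinity>) psi2"
      and max: "local_max_at (X \<infinity>) (D \<infinity>)
          (\<lambda>y. real_of_ereal (usc_envelope (X \<infinity>) (D \<infinity>) U y) - (psi1 y + psi2 y)) x0"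
    for psi1 psi2 x0
  proof -
    have x0: "x0 \<in> X \<infinity>" using max by (simp add: local_max_at_def)
    have max': "local_max_at (X \<infinity>) (D \<infinity>) (\<lambda>y. U y - (psi1 y + psi2 y)) x0"
      using max x0 by (simp add: local_max_at_def env)
    define p where "p = slope (X \<infinity>) (D \<infinity>) psi1 x0"
    define a where "a = real_of_ereal (usc_envelope (X \<infinity>) (D \<infinity>) (slope (X \<infinity>) (D \<infinity>) psi2) x0)"
    define us where "us n x = real_of_ereal (usc_envelope (X (enat n)) (D (enat n)) (u n) x)" for n x
    define Q where "Q j n z p' \<longleftrightarrow> z \<in> X (enat n) \<and> 0 \<le> p' \<and> dist z x0 < inverse (real (Suc j)) \<and>
        \<bar>us n z - U x0\<bar> < inverse (real (Suc j)) \<and> \<bar>p' - p\<bar> \<le> a + inverse (real (Suc j)) \<and>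
        H (enat n) z (us n z) p' \<le> inverse (real (Suc j))" for j n z p'
    have near: "\<exists>n\<ge>N. \<exists>z p'. Q j n z p'" for N j
      using subsolution_near[OF sub fin usc psi1 psi2 max'[unfolded U_def], of "inverse (real (Suc j))" N]
      unfolding Q_def us_def U_def p_def a_def by auto
    have "\<exists>n. \<exists>z p'. Q 0 n z p'" using near by blast
    moreover have "\<exists>m. (\<exists>z p'. Q (Suc j) m z p') \<and> n < m" for n j
      using near[of "Suc n" "Suc j"] Suc_le_lessD by blast
    ultimately have "\<exists>r. \<forall>j. (\<exists>z p'. Q j (r j) z p') \<and> r j < r (Suc j)"
      by (intro dependent_nat_choice)
    then obtain r where r: "\<And>j. \<exists>z p'. Q j (r j) z p'" "\<And>j. r j < r (Suc j)" by blast
    have r_mono: "strict_mono r" using r(2) by (simp add: strict_mono_Suc_iff)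
    obtain z p' where Q: "\<And>j. Q j (r j) (z j) (p' j)" using r(1) by metis
    have inv_le: "inverse (real (Suc j)) \<le> 1" for j by (simp add: inverse_le_1_iff)
    have "p' j \<in> {0..p + a + 1}" for j
      using Q[of j] inv_le[of j] by (auto simp: Q_def)
    then obtain pl q where q: "pl \<in> {0..p + a + 1}" "strict_mono q" "(p' \<circ> q) \<longlonglongrightarrow> pl"
      using seq_compactE[OF compact_imp_seq_compact[OF compact_Icc]] by metis
    define e where "e j = inverse (real (Suc (q j)))" for j
    have e0: "e \<longlonglongrightarrow> 0"
      unfolding e_def using LIMSEQ_subseq_LIMSEQ[OF LIMSEQ_inverse_real_of_nat q(2)] by (simp add: o_def)
    have rq: "strict_mono (r \<circ> q)" by (rule strict_mono_o[OF r_mono q(2)])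
    have Qq: "z (q j) \<in> X (enat ((r \<circ> q) j))" "0 \<le> p' (q j)" "dist (z (q j)) x0 < e j"
      "\<bar>us ((r \<circ> q) j) (z (q j)) - U x0\<bar> < e j" "\<bar>p' (q j) - p\<bar> \<le> a + e j"
      "H (enat ((r \<circ> q) j)) (z (q j)) (us ((r \<circ> q) j) (z (q j))) (p' (q j)) \<le> e j" for j
      using Q[of "q j"] by (auto simp: Q_def e_def)
    have zlim: "(\<lambda>j. z (q j)) \<longlonglongrightarrow> x0"
      unfolding tendsto_dist_iff[of _ x0]
      by (rule tendsto_sandwich[OF _ _ tendsto_const e0]) (use Qq(3) in \<open>auto intro!: always_eventually less_imp_le\<close>)
    have "(\<lambda>j. us ((r \<circ> q) j) (z (q j)) - U x0) \<longlonglongrightarrow> 0"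
      by (rule Lim_null_comparison[OF _ e0]) (use Qq(4) in \<open>auto intro!: always_eventually less_imp_le\<close>)
    then have uslim: "(\<lambda>j. us ((r \<circ> q) j) (z (q j))) \<longlonglongrightarrow> U x0" by (simp add: LIM_zero_iff)
    obtain s where s: "s \<in> approx_seqs X x0" "\<And>j. s ((r \<circ> q) j) = z (q j)"
      using approx_seqs_fill[OF x0 rq Qq(1) zlim] by metis
    have inv: "inv (r \<circ> q) ((r \<circ> q) j) = j" for j
      by (rule inv_f_f) (rule strict_mono_imp_inj_on[OF rq])
    \<comment> \<open>Values and momenta are completed by their limits off the subsequence, since
      \<open>H_conv\<close> takes full sequences.\<close>
    define us' where "us' n = (if n \<in> range (r \<circ> q) then
        us ((r \<circ> q) (inv (r \<circ> q) n)) (z (q (inv (r \<circ> q) n))) else U x0)" for n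
    define ps where "ps n = (if n \<in> range (r \<circ> q) then p' (q (inv (r \<circ> q) n)) else pl)" for n
    have us'lim: "us' \<longlonglongrightarrow> U x0"
      unfolding us'_def by (rule tendsto_fill_subseq[OF rq uslim tendsto_const])
    have pslim: "ps \<longlonglongrightarrow> pl"
      unfolding ps_def by (rule tendsto_fill_subseq[OF rq q(3)[unfolded o_def] tendsto_const])
    have ps0: "ps n \<ge> 0" for n using Qq(2) q(1) by (simp add: ps_def)
    have pl0: "pl \<ge> 0" using q(1) by simp
    have "(\<lambda>n. H (enat n) (s n) (us' n) (ps n)) \<longlonglongrightarrow> H \<infinity> x0 (U x0) pl"
      by (rule H_conv[OF x0 s(1) us'lim ps0 pl0 pslim])
    from LIMSEQ_subseq_LIMSEQ[OF this rq]
    have "(\<lambda>j. H (enat ((r \<circ> q) j)) (s ((r \<circ> q) j)) (us' ((r \<circ> q) j)) (ps ((r \<circ> q) j)))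
        \<longlonglongrightarrow> H \<infinity> x0 (U x0) pl" by (simp only: o_def)
    moreover have "us' ((r \<circ> q) j) = us ((r \<circ> q) j) (z (q j))" "ps ((r \<circ> q) j) = p' (q j)" for j
      by (simp_all only: us'_def ps_def inv rangeI if_True)
    ultimately have "(\<lambda>j. H (enat ((r \<circ> q) j)) (z (q j)) (us ((r \<circ> q) j) (z (q j))) (p' (q j)))
        \<longlonglongrightarrow> H \<infinity> x0 (U x0) pl" by (simp only: s(2))
    from LIMSEQ_le[OF this e0] have H0: "H \<infinity> x0 (U x0) pl \<le> 0" using Qq(6) by blast
    have "(\<lambda>j. \<bar>p' (q j) - p\<bar>) \<longlonglongrightarrow> \<bar>pl - p\<bar>"
      using q(3) unfolding o_def by (intro tendsto_intros)
    moreover have "(\<lambda>j. a + e j) \<longlonglongrightarrow> a + 0" by (intro tendsto_intros e0)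
    ultimately have "\<bar>pl - p\<bar> \<le> a + 0" by (rule LIMSEQ_le) (use Qq(5) in blast)
    then have "H_lower (H \<infinity>) a x0 (U x0) p \<le> 0"
      unfolding H_lower_def using pl0 H0 by (intro INF_lower2[of pl]) (auto simp: zero_ereal_def)
    then show ?thesis using env[OF x0] by (simp add: p_def a_def)
  qed
  then show ?thesis
    unfolding metric_viscosity_subsolution_def U_def[symmetric] using env by simp
qed

end

section \<open>Reflection of supersolutions\<close>

lemma slope_uminus: "slope M d (\<lambda>x. - u x) = slope M d u"
  by (auto simp: slope_def fun_eq_iff abs_minus_commute)

lemma slope_minus_uminus: "slope_minus M d (\<lambda>x. - u x) = slope_plus M d u"
  by (auto simp: slope_plus_def slope_minus_def fun_eq_iff add.commute)

lemma locally_Lipschitz_uminus: "locally_Lipschitz M d (\<lambda>x. - u x) = locally_Lipschitz M d u"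
proof -
  have "\<bar>- u y - - u z\<bar> = \<bar>u y - u z\<bar>" for y z by linarith
  then show ?thesis by (simp only: locally_Lipschitz_def)
qed

lemma C1_minus_uminus: "C1_minus M d (\<lambda>x. - u x) = C1_plus M d u"
  by (simp only: C1_minus_def C1_plus_def slope_uminus slope_minus_uminus locally_Lipschitz_uminus)

lemma usc_envelope_uminus: "usc_envelope M d (\<lambda>x. - u x) x = - lsc_envelope M d u x"
  by (simp add: usc_envelope_def lsc_envelope_def ereal_Limsup_uminus flip: uminus_ereal.simps)

lemma local_max_at_uminus: "local_max_at M d (\<lambda>x. - f x) x = local_min_at M d f x"
  by (simp add: local_max_at_def local_min_at_def)

text \<open>Reflection changes the sign of the value argument only; the momentum is a modulus of
  slope and is unaffected.\<close>

lemma H_lower_uminus: "H_lower (\<lambda>x v p. - H x (- v) p) a x (- v) p = - H_upper H a x v p"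
  by (simp add: H_lower_def H_upper_def ereal_INF_uminus_eq flip: uminus_ereal.simps)

lemma upper_semilimit_uminus: "upper_semilimit X (\<lambda>n x. - u n x) x = - lower_semilimit X u x"
  by (simp add: upper_semilimit_def lower_semilimit_def ereal_Limsup_uminus ereal_SUP_uminus_eq
      flip: uminus_ereal.simps)

lemma upper_semicontinuous_uminus:
  "upper_semicontinuous M d (\<lambda>x. - u x) = lower_semicontinuous M d u"
proof -
  have "{x \<in> M. - u x < a} = {x \<in> M. - a < u x}" for a by auto
  then show ?thesis
    unfolding upper_semicontinuous_def lower_semicontinuous_def by (metis minus_minus)
qed

text \<open>Negation is a bijection between the two classes of test functions and exchanges minima
  with maxima and lower with upper envelopes.\<close>

lemma supersolution_iff_subsolution_uminus:
  "metric_viscosity_supersolution M d H u \<longleftrightarrow>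
   metric_viscosity_subsolution M d (\<lambda>x v p. - H x (- v) p) (\<lambda>x. - u x)"
proof -
  \<comment> \<open>Quantifying over all functions is the same as quantifying over their
    negatives.\<close>
  have all_uminus: "(\<forall>(f :: 'a \<Rightarrow> real) (g :: 'a \<Rightarrow> real) x. R f g x) \<longleftrightarrow>
      (\<forall>f g x. R (\<lambda>y. - f y) (\<lambda>y. - g y) x)" for R :: "_ \<Rightarrow> _ \<Rightarrow> 'a \<Rightarrow> bool"
  proof
    assume *: "\<forall>f g x. R (\<lambda>y. - f y) (\<lambda>y. - g y) x"
    have "R f g x" for f g x
      using *[rule_format, of "\<lambda>y. - f y" "\<lambda>y. - g y" x] by simp
    then show "\<forall>f g x. R f g x" by blast
  qed blast
  have eq: "real_of_ereal (usc_envelope M d (\<lambda>x. - u x) y) - (- f1 y + - f2 y) =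
      - (real_of_ereal (lsc_envelope M d u y) - (f1 y + f2 y))" for f1 f2 y
    by (simp add: usc_envelope_uminus)
  have "metric_viscosity_subsolution M d (\<lambda>x v p. - H x (- v) p) (\<lambda>x. - u x) \<longleftrightarrow>
     (\<forall>x\<in>M. \<bar>usc_envelope M d (\<lambda>x. - u x) x\<bar> \<noteq> \<infinity>) \<and>
     (\<forall>f1 f2 x. C1_minus M d (\<lambda>x. - f1 x) \<and> locally_Lipschitz M d (\<lambda>x. - f2 x) \<and>
        local_max_at M d (\<lambda>y. real_of_ereal (usc_envelope M d (\<lambda>x. - u x) y) - (- f1 y + - f2 y)) x \<longrightarrow>
        H_lower (\<lambda>x v p. - H x (- v) p) (real_of_ereal (usc_envelope M d (slope M d (\<lambda>x. - f2 x)) x)) x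
          (real_of_ereal (usc_envelope M d (\<lambda>x. - u x) x)) (slope M d (\<lambda>x. - f1 x) x) \<le> 0)"
    unfolding metric_viscosity_subsolution_def
    by (rule arg_cong2[where f = "(\<and>)", OF refl all_uminus])
  also have "\<dots> \<longleftrightarrow> metric_viscosity_supersolution M d H u"
    unfolding metric_viscosity_supersolution_def eq local_max_at_uminus C1_minus_uminus
      locally_Lipschitz_uminus slope_uminus
    by (simp add: usc_envelope_uminus H_lower_uminus)
  finally show ?thesis by blast
qed

section \<open>Intrinsic metrics\<close>

text \<open>The partition \<open>[0, 1]\<close> contributes the chord.\<close>

lemma dist_le_curve_length:
  assumes "pathstart g = x" "pathfinish g = y"
  shows "ereal (dist x y) \<le> curve_length g"
  unfolding curve_length_def
  by (rule SUP_upper2[of "[0, 1]"]) (use assms in \<open>auto simp: pathstart_def pathfinish_def\<close>)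

lemma dist_le_intrinsic_dist:
  assumes "Metric_space S (intrinsic_dist S)" "x \<in> S" "y \<in> S"
  shows "dist x y \<le> intrinsic_dist S x y"
proof (cases "x = y")
  case True
  then show ?thesis using Metric_space.nonneg[OF assms(1)] by simp
next
  case False
  \<comment> \<open>An infinite \<open>intrinsic_edist\<close> would be read as 0, which the metric
    axioms exclude for distinct points.\<close>
  then have "intrinsic_dist S x y \<noteq> 0" using Metric_space.zero[OF assms] by simp
  moreover have "ereal (dist x y) \<le> intrinsic_edist S x y"
    unfolding intrinsic_edist_def by (intro INF_greatest) (auto intro: dist_le_curve_length)
  ultimately show ?thesis
    by (cases "intrinsic_edist S x y") (auto simp: intrinsic_dist_def)
qed

text \<open>Real suprema bound their members only over bounded sets; this makes the suprema in the
  Hausdorff distance meaningful.\<close>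

lemma bdd_above_infdist_compact:
  assumes "compact S"
  shows "bdd_above ((\<lambda>x. infdist x A) ` S)"
  using assms
  by (intro bounded_imp_bdd_above compact_imp_bounded compact_continuous_image continuous_intros)

lemma infdist_lessE:
  assumes "A \<noteq> {}" "infdist x A < e"
  obtains a where "a \<in> A" "dist x a < e"
  using assms by (auto simp: infdist_notempty cINF_less_iff)

text \<open>Hausdorff convergence yields approximating sequences. It also moves points of the
  approximating spaces to nearby points of the compact limit space, whose convergent subsequences
  carry the original points along.\<close>

lemma converging_spaces_intrinsic:
  fixes X :: "enat \<Rightarrow> 'a::metric_space set"
  assumes nonempty: "\<And>n. X n \<noteq> {}"
    and compact: "\<And>n. compact (X n)"
    and geodesic: "\<And>n. complete_geodesic_space (X n) (intrinsic_dist (X n))"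
    and hausdorff: "(\<lambda>n. max (SUP x\<in>X (enat n). infdist x (X \<infinity>))
                           (SUP x\<in>X \<infinity>. infdist x (X (enat n)))) \<longlonglongrightarrow> 0"
    and dist_conv: "\<And>a b as bs. \<lbrakk>a \<in> X \<infinity>; b \<in> X \<infinity>; as \<in> approx_seqs X a; bs \<in> approx_seqs X b\<rbrakk>
          \<Longrightarrow> (\<lambda>n. intrinsic_dist (X (enat n)) (as n) (bs n)) \<longlonglongrightarrow> intrinsic_dist (X \<infinity>) a b"
  shows "converging_spaces X (\<lambda>n. intrinsic_dist (X n))"
proof (rule converging_spaces.intro)
  define h where "h = (\<lambda>n. max (SUP x\<in>X (enat n). infdist x (X \<infinity>)) (SUP x\<in>X \<infinity>. infdist x (X (enat n))))"
  have h0: "h \<longlonglongrightarrow> 0" using hausdorff by (simp only: h_def)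
  have h1: "infdist x (X \<infinity>) \<le> h n" if "x \<in> X (enat n)" for x n
    using cSUP_upper[OF that bdd_above_infdist_compact[OF compact]] by (auto simp: h_def le_max_iff_disj)
  have h2: "infdist x (X (enat n)) \<le> h n" if "x \<in> X \<infinity>" for x n
    using cSUP_upper[OF that bdd_above_infdist_compact[OF compact]] by (auto simp: h_def le_max_iff_disj)
  \<comment> \<open>The positive summand makes the bounds on \<open>infdist\<close> strict, as
    choosing a nearby point requires.\<close>
  have lim: "(\<lambda>n. h n + inverse (real (Suc n))) \<longlonglongrightarrow> 0"
    by (rule tendsto_add_zero[OF h0 LIMSEQ_inverse_real_of_nat])
  show "geodesic_metric_space (X n) (intrinsic_dist (X n))" for n
    using geodesic by (simp only: geodesic_metric_space_iff)
  show "dist x y \<le> intrinsic_dist (X n) x y" if "x \<in> X n" "y \<in> X n" for n x y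
    using geodesic[of n] that unfolding complete_geodesic_space_def
    by (blast intro: dist_le_intrinsic_dist)
  show "\<exists>s. s \<in> approx_seqs X x" if x: "x \<in> X \<infinity>" for x
  proof -
    have "\<exists>y. y \<in> X (enat n) \<and> dist x y < h n + inverse (real (Suc n))" for n
    proof -
      have "infdist x (X (enat n)) < h n + inverse (real (Suc n))"
        using h2[OF x, of n] positive_imp_inverse_positive[of "real (Suc n)"] by linarith
      then show ?thesis by (rule infdist_lessE[OF nonempty]) blast
    qed
    then obtain s where s: "\<And>n. s n \<in> X (enat n)" "\<And>n. dist x (s n) < h n + inverse (real (Suc n))"
      by metis
    have "s \<longlonglongrightarrow> x"
      unfolding tendsto_dist_iff[of s x]
      by (rule tendsto_sandwich[OF _ _ tendsto_const lim])
        (use s(2) in \<open>auto intro!: always_eventually less_imp_le simp: dist_commute\<close>)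
    with s(1) show ?thesis by (auto simp: approx_seqs_def)
  qed
  show "\<exists>l\<in>X \<infinity>. \<exists>q. strict_mono q \<and> (z \<circ> q) \<longlonglongrightarrow> l"
    if r: "strict_mono r" and z: "\<And>k. z k \<in> X (enat (r k))" for r :: "nat \<Rightarrow> nat" and z :: "nat \<Rightarrow> 'a"
  proof -
    define e where "e = (\<lambda>k. h (r k) + inverse (real (Suc (r k))))"
    have e0: "e \<longlonglongrightarrow> 0"
      using LIMSEQ_subseq_LIMSEQ[OF lim r] by (simp only: o_def e_def)
    have "\<exists>y. y \<in> X \<infinity> \<and> dist (z k) y < e k" for k
    proof -
      have "infdist (z k) (X \<infinity>) < e k"
        using h1[OF z, of k] positive_imp_inverse_positive[of "real (Suc (r k))"]
        unfolding e_def by linarith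
      then show ?thesis by (rule infdist_lessE[OF nonempty]) blast
    qed
    then obtain y where y: "\<And>k. y k \<in> X \<infinity>" "\<And>k. dist (z k) (y k) < e k" by metis
    obtain l q where q: "l \<in> X \<infinity>" "strict_mono q" "(y \<circ> q) \<longlonglongrightarrow> l"
      using seq_compactE[OF compact_imp_seq_compact[OF compact], of y "\<infinity>"] y(1) by blast
    have ylim: "(\<lambda>k. dist (y (q k)) l) \<longlonglongrightarrow> 0"
      using tendsto_dist[OF q(3) tendsto_const[of l]] by (simp add: o_def)
    have elim: "(\<lambda>k. e (q k)) \<longlonglongrightarrow> 0"
      using LIMSEQ_subseq_LIMSEQ[OF e0 q(2)] by (simp only: o_def)
    have "dist ((z \<circ> q) k) l \<le> e (q k) + dist (y (q k)) l" for k
      using dist_triangle[of "z (q k)" l "y (q k)"] y(2)[of "q k"] by simp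
    then have "(z \<circ> q) \<longlonglongrightarrow> l"
      unfolding tendsto_dist_iff[of "z \<circ> q"]
      by (intro tendsto_sandwich[OF always_eventually always_eventually tendsto_const
            tendsto_add_zero[OF ylim elim]]) (simp_all add: add.commute)
    with q show ?thesis by blast
  qed
qed (rule dist_conv)

section \<open>The stability theorem\<close>

theorem theorem3p1:
  fixes X :: "enat \<Rightarrow> 'a::metric_space set"
    and H :: "enat \<Rightarrow> 'a \<Rightarrow> real \<Rightarrow> real \<Rightarrow> real"
  assumes proper: "\<And>(x::'a) r. compact (cball x r)"
    and nonempty: "\<And>n. X n \<noteq> {}"
    and compact: "\<And>n. compact (X n)"
    and geodesic: "\<And>n. complete_geodesic_space (X n) (intrinsic_dist (X n))"
    and hausdorff: "(\<lambda>n. max (SUP x\<in>X (enat n). infdist x (X \<infinity>))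
                           (SUP x\<in>X \<infinity>. infdist x (X (enat n)))) \<longlonglongrightarrow> 0"
    and dist_conv: "\<And>a b as bs. \<lbrakk>a \<in> X \<infinity>; b \<in> X \<infinity>; as \<in> approx_seqs X a; bs \<in> approx_seqs X b\<rbrakk>
          \<Longrightarrow> (\<lambda>n. intrinsic_dist (X (enat n)) (as n) (bs n)) \<longlonglongrightarrow> intrinsic_dist (X \<infinity>) a b"
    and H_conv: "\<And>x xs u us p ps. \<lbrakk>x \<in> X \<infinity>; xs \<in> approx_seqs X x; us \<longlonglongrightarrow> u;
          \<And>n. ps n \<ge> 0; p \<ge> 0; ps \<longlonglongrightarrow> p\<rbrakk>
          \<Longrightarrow> (\<lambda>n. H (enat n) (xs n) (us n) (ps n)) \<longlonglongrightarrow> H \<infinity> x u p"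
  shows
    "(\<forall>u :: nat \<Rightarrow> 'a \<Rightarrow> real.
        (\<forall>n. metric_viscosity_subsolution (X (enat n)) (intrinsic_dist (X (enat n)))
               (H (enat n)) (u n)) \<and>
        (\<forall>x\<in>X \<infinity>. \<bar>upper_semilimit X u x\<bar> \<noteq> \<infinity>) \<and>
        upper_semicontinuous (X \<infinity>) (intrinsic_dist (X \<infinity>))
          (\<lambda>x. real_of_ereal (upper_semilimit X u x))
      \<longrightarrow> metric_viscosity_subsolution (X \<infinity>) (intrinsic_dist (X \<infinity>)) (H \<infinity>)
            (\<lambda>x. real_of_ereal (upper_semilimit X u x)))
   \<and> (\<forall>u :: nat \<Rightarrow> 'a \<Rightarrow> real.
        (\<forall>n. metric_viscosity_supersolution (X (enat n)) (intrinsic_dist (X (enat n)))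
               (H (enat n)) (u n)) \<and>
        (\<forall>x\<in>X \<infinity>. \<bar>lower_semilimit X u x\<bar> \<noteq> \<infinity>) \<and>
        lower_semicontinuous (X \<infinity>) (intrinsic_dist (X \<infinity>))
          (\<lambda>x. real_of_ereal (lower_semilimit X u x))
      \<longrightarrow> metric_viscosity_supersolution (X \<infinity>) (intrinsic_dist (X \<infinity>)) (H \<infinity>)
            (\<lambda>x. real_of_ereal (lower_semilimit X u x)))"
proof -
  interpret converging_spaces X "\<lambda>n. intrinsic_dist (X n)"
    by (rule converging_spaces_intrinsic[OF nonempty compact geodesic hausdorff dist_conv])
  show ?thesis
  proof (intro conjI allI impI; elim conjE)
    fix u :: "nat \<Rightarrow> 'a \<Rightarrow> real"
    assume sub: "\<forall>n. metric_viscosity_subsolution (X (enat n)) (intrinsic_dist (X (enat n)))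
               (H (enat n)) (u n)"
      and fin: "\<forall>x\<in>X \<infinity>. \<bar>upper_semilimit X u x\<bar> \<noteq> \<infinity>"
      and usc: "upper_semicontinuous (X \<infinity>) (intrinsic_dist (X \<infinity>))
          (\<lambda>x. real_of_ereal (upper_semilimit X u x))"
    show "metric_viscosity_subsolution (X \<infinity>) (intrinsic_dist (X \<infinity>)) (H \<infinity>)
            (\<lambda>x. real_of_ereal (upper_semilimit X u x))"
      by (rule subsolution_stability[OF H_conv spec[OF sub] bspec[OF fin] usc])
  next
    fix u :: "nat \<Rightarrow> 'a \<Rightarrow> real"
    assume super: "\<forall>n. metric_viscosity_supersolution (X (enat n)) (intrinsic_dist (X (enat n)))
               (H (enat n)) (u n)"
      and fin: "\<forall>x\<in>X \<infinity>. \<bar>lower_semilimit X u x\<bar> \<noteq> \<infinity>"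
      and lsc: "lower_semicontinuous (X \<infinity>) (intrinsic_dist (X \<infinity>))
          (\<lambda>x. real_of_ereal (lower_semilimit X u x))"
    \<comment> \<open>The reflected Hamiltonians inherit the convergence hypothesis by evaluating
      \<open>H\<close> along the negated values.\<close>
    let ?H = "\<lambda>n x v p. - H n x (- v) p" and ?u = "\<lambda>n x. - u n x"
    have semilimit: "real_of_ereal (upper_semilimit X ?u x) = - real_of_ereal (lower_semilimit X u x)" for x
      by (simp add: upper_semilimit_uminus)
    have "metric_viscosity_subsolution (X \<infinity>) (intrinsic_dist (X \<infinity>)) (?H \<infinity>)
            (\<lambda>x. real_of_ereal (upper_semilimit X ?u x))"
    proof (rule subsolution_stability[where H = ?H])
      show "metric_viscosity_subsolution (X (enat n)) (intrinsic_dist (X (enat n))) (?H (enat n)) (?u n)" for n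
        using super by (simp add: supersolution_iff_subsolution_uminus)
      show "\<bar>upper_semilimit X ?u x\<bar> \<noteq> \<infinity>" if "x \<in> X \<infinity>" for x
        using fin that by (simp add: upper_semilimit_uminus)
      show "upper_semicontinuous (X \<infinity>) (intrinsic_dist (X \<infinity>)) (\<lambda>x. real_of_ereal (upper_semilimit X ?u x))"
        unfolding semilimit upper_semicontinuous_uminus by (rule lsc)
      fix x xs and v p :: real and vs ps :: "nat \<Rightarrow> real"
      assume x: "x \<in> X \<infinity>" "xs \<in> approx_seqs X x" and v: "vs \<longlonglongrightarrow> v"
        and p: "\<And>n. 0 \<le> ps n" "0 \<le> p" "ps \<longlonglongrightarrow> p"
      show "(\<lambda>n. ?H (enat n) (xs n) (vs n) (ps n)) \<longlonglongrightarrow> ?H \<infinity> x v p"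
        by (rule tendsto_minus[OF H_conv[OF x tendsto_minus[OF v] p]])
    qed
    then show "metric_viscosity_supersolution (X \<infinity>) (intrinsic_dist (X \<infinity>)) (H \<infinity>)
            (\<lambda>x. real_of_ereal (lower_semilimit X u x))"
      by (simp only: semilimit supersolution_iff_subsolution_uminus)
  qed
qed

end
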